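(* The operator $\mathcal L_W:\mathcal D_W\to L^2(\mathbb T^d)$ defined in the context has the following properties. (a) The domain $\mathcal D_W$ is dense in $L^2(\mathbb T^d)$. In particular, the set of eigenvectors $\mathcal A_W=\{h_k\}_{k\ge 0}$ forms a complete orthonormal system of $L^2(\mathbb T^d)$. (b) The eigenvalues of $-\mathcal L_W$ form a countable set $\{\alpha_k\}_{k\ge 0}$. All eigenvalues have finite multiplicity, and it is possible to re-enumerate them so that $0=\alpha_0\le\alpha_1\le\cdots$ and $\lim_{n\to\infty}\alpha_n=\infty$. (c) The operator $\mathbb I-\mathcal L_W:\mathcal D_W\to L^2(\mathbb T^d)$ is bijective, where $\mathbb I$ is the identity. (d) $\mathcal L_W:\mathcal D_W\to L^2(\mathbb T^d)$ is self-adjoint and non-positive: $\langle -\mathcal L_W f,f\rangle\ge 0$ for all $f\in\mathcal D_W$. (e) $\mathcal L_W$ is dissipative: $\|\lambda g\|\le\|(\lambda\mathbb I-\mathcal L_W)g\|$ for all $g\in\mathcal D_W$ and $\lambda>0$.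
   Context: Let $d>1$ be an integer. For $k=1,\dots,d$ let $W_k:\mathbb R\to\mathbb R$ be strictly increasing and càdlàg (right continuous with left limits), with $W_k(0)=0$ and $W_k(u+1)-W_k(u)=W_k(1)-W_k(0)$ for all $u\in\mathbb R$. Put $W(x_1,\dots,x_d)=\sum_{k=1}^d W_k(x_k)$. Let $\mathbb T=[0,1)$ be the one-dimensional torus, $\mathbb T^d$ the $d$-dimensional torus; $L^2(\mathbb T)$, $L^2(\mathbb T^d)$ are real $L^2$ spaces for Lebesgue measure, with inner product $\langle\cdot,\cdot\rangle$ and norm $\|\cdot\|$. One-dimensional operators. $\mathcal D_{W_k}$ is the set of $f\in L^2(\mathbb T)$ of the form $$f(x)=a+bW_k(x)+\int_{(0,x]}W_k(dy)\int_0^y\mathfrak f(z)\,dz$$ for some $a,b\in\mathbb R$ and $\mathfrak f\in L^2(\mathbb T)$ with $\int_0^1\mathfrak f(z)\,dz=0$ and $\int_{(0,1]}W_k(dy)\big(b+\int_0^y\mathfrak f(z)\,dz\big)=0$; and $\mathcal L_{W_k}f=\mathfrak f$ (formally $\mathcal L_{W_k}=\frac{d}{dx}\frac{d}{dW_k}$). It is known that $\mathcal L_{W_k}:\mathcal D_{W_k}\to L^2(\mathbb T)$ is self-adjoint, non-positive, and has a countable complete orthonormal system of eigenvectors in $L^2(\mathbb T)$; moreover the eigenvalues of $-\mathcal L_{W_k}$ are countable, have finite multiplicity, and can be ordered $0=\lambda_0\le\lambda_1\le\cdots\to\infty$. Fix such an orthonormal system $\mathcal A_{W_k}$ of eigenvectors.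 The $d$-dimensional operator. Let $\mathcal A_W=\{f:\mathbb T^d\to\mathbb R:\ f(x_1,\dots,x_d)=\prod_{k=1}^d f_k(x_k),\ f_k\in\mathcal A_{W_k}\}$, a countable orthonormal set in $L^2(\mathbb T^d)$, and let $\mathbb D_W$ be its linear span. Define $\mathbb L_W:\mathbb D_W\to L^2(\mathbb T^d)$ linearly by $$\mathbb L_W\Big(\prod_{k=1}^d f_k\Big)(x_1,\dots,x_d)=\sum_{k=1}^d\Big(\prod_{j\ne k}f_j(x_j)\Big)\,\mathcal L_{W_k}f_k(x_k),\qquad f_k\in\mathcal A_{W_k}.$$ Every element of $\mathcal A_W$ is an eigenvector of $\mathbb L_W$. Enumerate $\mathcal A_W=\{h_k\}_{k\ge 0}$ and let $\alpha_k$ be the eigenvalue of $-\mathbb L_W$ associated with $h_k$. Define $$\mathcal D_W=\Big\{v=\sum_{k\ge 0}v_kh_k\in L^2(\mathbb T^d):\ \sum_{k\ge0}v_k^2\alpha_k^2<\infty\Big\},\qquad -\mathcal L_Wv=\sum_{k\ge0}\alpha_kv_kh_k .$$ *)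

theory Defs
  imports "HOL-Analysis.Analysis"
begin

section \<open>Real \<open>L\<^sup>2\<close> spaces\<close>

text \<open>
  An element of \<open>L\<^sup>2(M)\<close> is represented by a square-integrable function, and two such functions
  represent the same element iff they agree almost everywhere.  A set of representatives
  need not be closed under this equivalence: \<open>D\<close> below is, whereas an orthonormal system
  contains one representative per element.  An unbounded operator is given by its domain \<open>D\<close> (a set of
  representatives) and a map \<open>T\<close> on representatives.
\<close>

definition L2 :: "'a measure \<Rightarrow> ('a \<Rightarrow> real) set" where
  "L2 M = {f \<in> borel_measurable M. integrable M (\<lambda>x. (f x)\<^sup>2)}"

abbreviation ae_eq :: "'a measure \<Rightarrow> ('a \<Rightarrow> real) \<Rightarrow> ('a \<Rightarrow> real) \<Rightarrow> bool" where
  "ae_eq M f g \<equiv> (AE x in M. f x = g x)"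

definition l2_inner :: "'a measure \<Rightarrow> ('a \<Rightarrow> real) \<Rightarrow> ('a \<Rightarrow> real) \<Rightarrow> real" where
  "l2_inner M f g = (LINT x|M. f x * g x)"

definition l2_norm :: "'a measure \<Rightarrow> ('a \<Rightarrow> real) \<Rightarrow> real" where
  "l2_norm M f = sqrt (l2_inner M f f)"

definition l2_sums :: "'a measure \<Rightarrow> (nat \<Rightarrow> 'a \<Rightarrow> real) \<Rightarrow> ('a \<Rightarrow> real) \<Rightarrow> bool" where
  "l2_sums M u s \<longleftrightarrow> (\<forall>k. u k \<in> L2 M) \<and> s \<in> L2 M \<and>
     (\<lambda>n. l2_norm M (\<lambda>x. s x - (\<Sum>k<n. u k x))) \<longlonglongrightarrow> 0"

definition l2_dense :: "'a measure \<Rightarrow> ('a \<Rightarrow> real) set \<Rightarrow> bool" where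
  "l2_dense M D \<longleftrightarrow> D \<subseteq> L2 M \<and>
     (\<forall>f\<in>L2 M. \<forall>\<epsilon>>0. \<exists>g\<in>D. l2_norm M (\<lambda>x. f x - g x) < \<epsilon>)"

definition l2_span :: "'a measure \<Rightarrow> ('a \<Rightarrow> real) set \<Rightarrow> ('a \<Rightarrow> real) set" where
  "l2_span M S = {f \<in> L2 M. \<exists>F c. finite F \<and> F \<subseteq> S \<and> ae_eq M f (\<lambda>x. \<Sum>g\<in>F. c g * g x)}"

definition l2_finite_dim :: "'a measure \<Rightarrow> ('a \<Rightarrow> real) set \<Rightarrow> bool" where
  "l2_finite_dim M E \<longleftrightarrow> (\<exists>F. finite F \<and> F \<subseteq> L2 M \<and> E \<subseteq> l2_span M F)"

definition l2_orthonormal :: "'a measure \<Rightarrow> ('a \<Rightarrow> real) set \<Rightarrow> bool" where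
  "l2_orthonormal M S \<longleftrightarrow> S \<subseteq> L2 M \<and>
     (\<forall>f\<in>S. \<forall>g\<in>S. l2_inner M f g = (if f = g then 1 else 0))"

definition l2_complete_orthonormal :: "'a measure \<Rightarrow> ('a \<Rightarrow> real) set \<Rightarrow> bool" where
  "l2_complete_orthonormal M S \<longleftrightarrow> l2_orthonormal M S \<and> l2_dense M (l2_span M S)"


section \<open>Unbounded operators on \<open>L\<^sup>2\<close>\<close>

definition l2_operator ::
  "'a measure \<Rightarrow> ('a \<Rightarrow> real) set \<Rightarrow> (('a \<Rightarrow> real) \<Rightarrow> 'a \<Rightarrow> real) \<Rightarrow> bool" where
  "l2_operator M D T \<longleftrightarrow>
     D \<subseteq> L2 M \<and> (\<lambda>_. 0) \<in> D \<and> T ` D \<subseteq> L2 M \<and>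
     (\<forall>f\<in>D. \<forall>g\<in>L2 M. ae_eq M f g \<longrightarrow> g \<in> D \<and> ae_eq M (T f) (T g)) \<and>
     (\<forall>f\<in>D. \<forall>g\<in>D. \<forall>a b. (\<lambda>x. a * f x + b * g x) \<in> D \<and>
        ae_eq M (T (\<lambda>x. a * f x + b * g x)) (\<lambda>x. a * T f x + b * T g x))"

definition l2_eigenvector ::
  "'a measure \<Rightarrow> ('a \<Rightarrow> real) set \<Rightarrow> (('a \<Rightarrow> real) \<Rightarrow> 'a \<Rightarrow> real) \<Rightarrow> real \<Rightarrow> ('a \<Rightarrow> real) \<Rightarrow> bool"
where
  "l2_eigenvector M D T \<mu> f \<longleftrightarrow>
     f \<in> D \<and> \<not> ae_eq M f (\<lambda>_. 0) \<and> ae_eq M (T f) (\<lambda>x. \<mu> * f x)"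

definition l2_eigenvalues ::
  "'a measure \<Rightarrow> ('a \<Rightarrow> real) set \<Rightarrow> (('a \<Rightarrow> real) \<Rightarrow> 'a \<Rightarrow> real) \<Rightarrow> real set" where
  "l2_eigenvalues M D T = {\<mu>. \<exists>f. l2_eigenvector M D T \<mu> f}"

definition l2_eigenspace ::
  "'a measure \<Rightarrow> ('a \<Rightarrow> real) set \<Rightarrow> (('a \<Rightarrow> real) \<Rightarrow> 'a \<Rightarrow> real) \<Rightarrow> real \<Rightarrow> ('a \<Rightarrow> real) set" where
  "l2_eigenspace M D T \<mu> = {f \<in> D. ae_eq M (T f) (\<lambda>x. \<mu> * f x)}"

definition l2_graph ::
  "'a measure \<Rightarrow> ('a \<Rightarrow> real) set \<Rightarrow> (('a \<Rightarrow> real) \<Rightarrow> 'a \<Rightarrow> real) \<Rightarrow>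
    (('a \<Rightarrow> real) \<times> ('a \<Rightarrow> real)) set" where
  "l2_graph M D T = {(f, w). f \<in> D \<and> w \<in> L2 M \<and> ae_eq M (T f) w}"

definition l2_adjoint_graph ::
  "'a measure \<Rightarrow> ('a \<Rightarrow> real) set \<Rightarrow> (('a \<Rightarrow> real) \<Rightarrow> 'a \<Rightarrow> real) \<Rightarrow>
    (('a \<Rightarrow> real) \<times> ('a \<Rightarrow> real)) set" where
  "l2_adjoint_graph M D T = {(g, w). g \<in> L2 M \<and> w \<in> L2 M \<and>
     (\<forall>f\<in>D. l2_inner M (T f) g = l2_inner M f w)}"

text \<open>Equality of the graphs includes equality of the domains of the operator and its adjoint.\<close>

definition l2_self_adjoint ::
  "'a measure \<Rightarrow> ('a \<Rightarrow> real) set \<Rightarrow> (('a \<Rightarrow> real) \<Rightarrow> 'a \<Rightarrow> real) \<Rightarrow> bool" where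
  "l2_self_adjoint M D T \<longleftrightarrow>
     l2_operator M D T \<and> l2_dense M D \<and> l2_adjoint_graph M D T = l2_graph M D T"

definition l2_bijective ::
  "'a measure \<Rightarrow> ('a \<Rightarrow> real) set \<Rightarrow> (('a \<Rightarrow> real) \<Rightarrow> 'a \<Rightarrow> real) \<Rightarrow> bool" where
  "l2_bijective M D T \<longleftrightarrow>
     T ` D \<subseteq> L2 M \<and>
     (\<forall>f\<in>D. \<forall>g\<in>D. ae_eq M (T f) (T g) \<longrightarrow> ae_eq M f g) \<and>
     (\<forall>g\<in>L2 M. \<exists>f\<in>D. ae_eq M (T f) g)"


section \<open>The one-dimensional operators\<close>

text \<open>
  Points of the torus are represented in \<open>[0,1)\<close>; points of the \<open>d\<close>-dimensional torus are
  families indexed by \<open>{1..d}\<close>.  The Borel sigma-algebra suffices, since every Lebesgue measurable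
  function agrees almost everywhere with a Borel one.
\<close>

definition torus :: "real measure" where
  "torus = restrict_space lborel {0..<1}"

definition torus_pow :: "nat \<Rightarrow> (nat \<Rightarrow> real) measure" where
  "torus_pow d = (\<Pi>\<^sub>M k\<in>{1..d}. torus)"

definition admissible :: "(real \<Rightarrow> real) \<Rightarrow> bool" where
  "admissible W \<longleftrightarrow>
     strict_mono W \<and>
     (\<forall>u. continuous (at_right u) W) \<and> (\<forall>u. \<exists>l. (W \<longlongrightarrow> l) (at_left u)) \<and>
     W 0 = 0 \<and> (\<forall>u. W (u + 1) - W u = W 1 - W 0)"

text \<open>
  \<open>gen_deriv W f \<phi>\<close> says that \<open>f\<close> is in the domain of \<open>d/dx d/dW\<close> with \<open>\<phi>\<close> as the image;
  \<open>interval_measure W\<close> is the Lebesgue-Stieltjes measure \<open>W(dy)\<close>, with mass \<open>W t - W s\<close> on \<open>(s,t]\<close>.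
\<close>

definition gen_deriv :: "(real \<Rightarrow> real) \<Rightarrow> (real \<Rightarrow> real) \<Rightarrow> (real \<Rightarrow> real) \<Rightarrow> bool" where
  "gen_deriv W f \<phi> \<longleftrightarrow>
     f \<in> L2 torus \<and> \<phi> \<in> L2 torus \<and> (LINT z:{0..<1}|lborel. \<phi> z) = 0 \<and>
     (\<exists>a b.
        (LINT y:{0<..1}|interval_measure W. b + (LINT z:{0..<y}|lborel. \<phi> z)) = 0 \<and>
        ae_eq torus f (\<lambda>x. a + b * W x +
          (LINT y:{0<..x}|interval_measure W. LINT z:{0..<y}|lborel. \<phi> z)))"

definition dom1 :: "(real \<Rightarrow> real) \<Rightarrow> (real \<Rightarrow> real) set" where
  "dom1 W = {f. \<exists>\<phi>. gen_deriv W f \<phi>}"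

text \<open>For admissible \<open>W\<close> the image is determined up to null sets; a representative is chosen.\<close>

definition op1 :: "(real \<Rightarrow> real) \<Rightarrow> (real \<Rightarrow> real) \<Rightarrow> real \<Rightarrow> real" where
  "op1 W f = (SOME \<phi>. gen_deriv W f \<phi>)"

definition eigenbasis1 :: "(real \<Rightarrow> real) \<Rightarrow> (real \<Rightarrow> real) set \<Rightarrow> bool" where
  "eigenbasis1 W A \<longleftrightarrow>
     countable A \<and> l2_complete_orthonormal torus A \<and>
     (\<forall>f\<in>A. \<exists>\<mu>. l2_eigenvector torus (dom1 W) (op1 W) \<mu> f)"


section \<open>The \<open>d\<close>-dimensional operator\<close>

definition tensor :: "nat \<Rightarrow> (nat \<Rightarrow> real \<Rightarrow> real) \<Rightarrow> (nat \<Rightarrow> real) \<Rightarrow> real" where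
  "tensor d f = (\<lambda>x. \<Prod>k=1..d. f k (x k))"

definition tensor_basis :: "nat \<Rightarrow> (nat \<Rightarrow> (real \<Rightarrow> real) set) \<Rightarrow> ((nat \<Rightarrow> real) \<Rightarrow> real) set" where
  "tensor_basis d A = {tensor d f |f. \<forall>k\<in>{1..d}. f k \<in> A k}"

definition tensor_image ::
  "nat \<Rightarrow> (nat \<Rightarrow> real \<Rightarrow> real) \<Rightarrow> (nat \<Rightarrow> real \<Rightarrow> real) \<Rightarrow> (nat \<Rightarrow> real) \<Rightarrow> real" where
  "tensor_image d W f =
     (\<lambda>x. \<Sum>k=1..d. (\<Prod>j\<in>{1..d} - {k}. f j (x j)) * op1 (W k) (f k) (x k))"

definition pre_dom ::
  "nat \<Rightarrow> (nat \<Rightarrow> (real \<Rightarrow> real) set) \<Rightarrow> ((nat \<Rightarrow> real) \<Rightarrow> real) set" where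
  "pre_dom d A = l2_span (torus_pow d) (tensor_basis d A)"

text \<open>The linear extension to \<open>pre_dom d A\<close> of the map \<open>tensor d f \<mapsto> tensor_image d W f\<close>.\<close>

definition pre_op ::
  "nat \<Rightarrow> (nat \<Rightarrow> real \<Rightarrow> real) \<Rightarrow> (nat \<Rightarrow> (real \<Rightarrow> real) set) \<Rightarrow>
    ((nat \<Rightarrow> real) \<Rightarrow> real) \<Rightarrow> (nat \<Rightarrow> real) \<Rightarrow> real" where
  "pre_op d W A v = (SOME w. w \<in> L2 (torus_pow d) \<and>
     (\<exists>(N::nat) c f. (\<forall>i<N. \<forall>k\<in>{1..d}. f i k \<in> A k) \<and>
        ae_eq (torus_pow d) v (\<lambda>x. \<Sum>i<N. c i * tensor d (f i) x) \<and>
        ae_eq (torus_pow d) w (\<lambda>x. \<Sum>i<N. c i * tensor_image d W (f i) x)))"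

definition diag_dom ::
  "'a measure \<Rightarrow> (nat \<Rightarrow> 'a \<Rightarrow> real) \<Rightarrow> (nat \<Rightarrow> real) \<Rightarrow> ('a \<Rightarrow> real) set" where
  "diag_dom M h \<alpha> = {v \<in> L2 M. \<exists>c. l2_sums M (\<lambda>k x. c k * h k x) v \<and>
     summable (\<lambda>k. (c k)\<^sup>2 * (\<alpha> k)\<^sup>2)}"

text \<open>The sign: \<open>-diag_op M h \<alpha> v\<close> is the sum of the series with terms \<open>\<alpha>\<^sub>k v\<^sub>k h\<^sub>k\<close>.\<close>

definition diag_op ::
  "'a measure \<Rightarrow> (nat \<Rightarrow> 'a \<Rightarrow> real) \<Rightarrow> (nat \<Rightarrow> real) \<Rightarrow> ('a \<Rightarrow> real) \<Rightarrow> 'a \<Rightarrow> real" where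
  "diag_op M h \<alpha> v = (SOME w. w \<in> L2 M \<and>
     (\<exists>c. l2_sums M (\<lambda>k x. c k * h k x) v \<and>
        l2_sums M (\<lambda>k x. \<alpha> k * c k * h k x) (\<lambda>x. - w x)))"

end

theory Submission
  imports Defs "HOL-Probability.Infinite_Product_Measure"
begin

text \<open>
  The operator is diagonal in the tensor basis, and everything follows from three facts: the basis is
  complete, its eigenvalues are non-negative with finitely many below any bound, and \<open>0\<close> is one of them.

  For a diagonal operator with these properties, passing to Fourier coefficients identifies \<open>L\<^sup>2\<close> with the
  sequence space \<open>\<ell>\<^sup>2\<close> (this needs the Riesz--Fischer theorem, \<open>Riesz_Fischer\<close>), where the operator multiplies
  the \<open>k\<close>-th coefficient by \<open>- \<alpha> k\<close>.  Density of the domain, the description of the eigenspaces,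
  bijectivity of the resolvent at \<open>1\<close>, self-adjointness and dissipativity are then statements about
  sequences; this is the locale \<open>diagonal_operator\<close>.

  The spectral facts in one dimension are derived from the definition of the generalized derivative.  Green's
  formula (\<open>gen_deriv_flux\<close>) writes \<open>\<langle>- op1 W f, g\<rangle>\<close> as \<open>\<integral> p q W(dy)\<close>, where \<open>p\<close> and \<open>q\<close> are the fluxes
  \<open>df/dW\<close> and \<open>dg/dW\<close>; hence eigenvalues are non-negative.  An element of the domain is bounded pointwise by
  its norm and its energy \<open>\<integral> p\<^sup>2 W(dy)\<close>, as in the Sobolev embedding.  Applied to linear combinations of
  orthonormal eigenvectors with eigenvalue at most \<open>C\<close>, this bounds the number of such eigenvectors
  by \<open>2 + 2 * W 1 * C\<close> (\<open>card_low_eigenvectors\<close>).  The eigenvalue \<open>0\<close> occurs because eigenvectors with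
  nonzero eigenvalue have mean zero and so are not complete on their own (\<open>ex_zero_eigval\<close>).

  In \<open>d\<close> dimensions the eigenvalue of a tensor product is the sum of the eigenvalues of the factors, so
  finiteness below a bound and the presence of \<open>0\<close> carry over.  Completeness of the tensor basis
  (\<open>tensor_total\<close>) holds because a function orthogonal to the basis is orthogonal to all tensor products
  of \<open>L\<^sup>2\<close> functions, in particular to the indicators of boxes, which determine a function.
\<close>

section \<open>Real \<open>L\<^sup>2\<close> spaces\<close>

lemma L2_measurable: "f \<in> L2 M \<Longrightarrow> f \<in> borel_measurable M"
  by (simp add: L2_def)

lemma L2_integrable_square: "f \<in> L2 M \<Longrightarrow> integrable M (\<lambda>x. (f x)\<^sup>2)"
  by (simp add: L2_def)

lemma L2_integrable_mult:
  assumes "f \<in> L2 M" "g \<in> L2 M"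
  shows "integrable M (\<lambda>x. f x * g x)"
proof (rule Bochner_Integration.integrable_bound)
  show "integrable M (\<lambda>x. (f x)\<^sup>2 + (g x)\<^sup>2)"
    using assms by (intro Bochner_Integration.integrable_add L2_integrable_square)
  show "(\<lambda>x. f x * g x) \<in> borel_measurable M"
    using assms[THEN L2_measurable] by measurable
  have "\<bar>a * b\<bar> \<le> a\<^sup>2 + b\<^sup>2" for a b :: real
    using sum_squares_bound[of a b] sum_squares_bound[of a "-b"]
      zero_le_power2[of a] zero_le_power2[of b] by (auto simp: abs_le_iff)
  then show "AE x in M. norm (f x * g x) \<le> norm ((f x)\<^sup>2 + (g x)\<^sup>2)"
    by simp
qed

lemma L2_lincomb:
  assumes "f \<in> L2 M" "g \<in> L2 M"
  shows "(\<lambda>x. a * f x + b * g x) \<in> L2 M"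
proof -
  have "integrable M (\<lambda>x. a\<^sup>2 * (f x)\<^sup>2 + b\<^sup>2 * (g x)\<^sup>2 + 2 * a * b * (f x * g x))"
    using L2_integrable_mult[OF assms] assms[THEN L2_integrable_square] by auto
  moreover have "(a * u + b * v)\<^sup>2 = a\<^sup>2 * u\<^sup>2 + b\<^sup>2 * v\<^sup>2 + 2 * a * b * (u * v)" for u v :: real
    by (simp add: power2_eq_square algebra_simps)
  ultimately show ?thesis
    using assms[THEN L2_measurable] by (simp add: L2_def)
qed

lemma L2_zero: "(\<lambda>_. 0) \<in> L2 M"
  by (simp add: L2_def)

lemma L2_scale: "f \<in> L2 M \<Longrightarrow> (\<lambda>x. a * f x) \<in> L2 M"
  using L2_lincomb[of f M f a 0] by simp

lemma L2_uminus: "f \<in> L2 M \<Longrightarrow> (\<lambda>x. - f x) \<in> L2 M"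
  using L2_scale[of f M "-1"] by simp

lemma L2_add: "f \<in> L2 M \<Longrightarrow> g \<in> L2 M \<Longrightarrow> (\<lambda>x. f x + g x) \<in> L2 M"
  using L2_lincomb[of f M g 1 1] by simp

lemma L2_diff: "f \<in> L2 M \<Longrightarrow> g \<in> L2 M \<Longrightarrow> (\<lambda>x. f x - g x) \<in> L2 M"
  using L2_lincomb[of f M g 1 "-1"] by simp

lemma L2_sum: "(\<And>i. i \<in> I \<Longrightarrow> f i \<in> L2 M) \<Longrightarrow> (\<lambda>x. \<Sum>i\<in>I. f i x) \<in> L2 M"
  by (induction I rule: infinite_finite_induct) (auto simp: L2_zero intro: L2_add)

lemmas L2_intros = L2_zero L2_scale L2_uminus L2_add L2_diff L2_sum

lemma L2_bounded:
  assumes "finite_measure M" "f \<in> borel_measurable M" "\<And>x. x \<in> space M \<Longrightarrow> \<bar>f x\<bar> \<le> B"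
  shows "f \<in> L2 M"
proof -
  have "(f x)\<^sup>2 \<le> B\<^sup>2" if "x \<in> space M" for x
    using assms(3)[OF that] by (metis abs_le_square_iff abs_ge_zero abs_of_nonneg order_trans)
  then have "integrable M (\<lambda>x. (f x)\<^sup>2)"
    using assms(1,2) by (intro finite_measure.integrable_const_bound[where B = "B\<^sup>2"]) auto
  then show ?thesis using assms(2) by (simp add: L2_def)
qed

lemma l2_inner_commute: "l2_inner M f g = l2_inner M g f"
  by (simp add: l2_inner_def mult.commute)

lemma l2_inner_cong_AE:
  assumes "f \<in> L2 M" "g \<in> L2 M" "f' \<in> L2 M" "g' \<in> L2 M" "ae_eq M f f'" "ae_eq M g g'"
  shows "l2_inner M f g = l2_inner M f' g'"
  unfolding l2_inner_def
proof (rule integral_cong_AE)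
  show "(\<lambda>x. f x * g x) \<in> borel_measurable M" "(\<lambda>x. f' x * g' x) \<in> borel_measurable M"
    using assms by (auto intro: borel_measurable_times L2_measurable)
  show "AE x in M. f x * g x = f' x * g' x"
    using assms(5,6) by eventually_elim simp
qed

lemma l2_inner_lincomb_left:
  assumes "f \<in> L2 M" "g \<in> L2 M" "u \<in> L2 M"
  shows "l2_inner M (\<lambda>x. a * f x + b * g x) u = a * l2_inner M f u + b * l2_inner M g u"
proof -
  have "(a * f x + b * g x) * u x = a * (f x * u x) + b * (g x * u x)" for x
    by (simp add: algebra_simps)
  then show ?thesis
    using L2_integrable_mult[OF assms(1,3)] L2_integrable_mult[OF assms(2,3)]
    by (simp add: l2_inner_def)
qed

lemma l2_inner_scale_left: "l2_inner M (\<lambda>x. a * f x) u = a * l2_inner M f u"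
  by (simp add: l2_inner_def mult.assoc)

lemma l2_inner_scale_right: "l2_inner M u (\<lambda>x. a * f x) = a * l2_inner M u f"
  by (simp add: l2_inner_commute[of M u] l2_inner_scale_left)

lemma l2_inner_uminus_left: "l2_inner M (\<lambda>x. - f x) u = - l2_inner M f u"
  by (simp add: l2_inner_def)

lemma l2_inner_zero_left: "l2_inner M (\<lambda>x. 0) u = 0"
  by (simp add: l2_inner_def)

lemma l2_inner_add_left:
  "f \<in> L2 M \<Longrightarrow> g \<in> L2 M \<Longrightarrow> u \<in> L2 M \<Longrightarrow>
    l2_inner M (\<lambda>x. f x + g x) u = l2_inner M f u + l2_inner M g u"
  using l2_inner_lincomb_left[of f M g u 1 1] by simp

lemma l2_inner_diff_left:
  "f \<in> L2 M \<Longrightarrow> g \<in> L2 M \<Longrightarrow> u \<in> L2 M \<Longrightarrow>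
    l2_inner M (\<lambda>x. f x - g x) u = l2_inner M f u - l2_inner M g u"
  using l2_inner_lincomb_left[of f M g u 1 "-1"] by simp

lemma l2_inner_diff_right:
  "f \<in> L2 M \<Longrightarrow> g \<in> L2 M \<Longrightarrow> u \<in> L2 M \<Longrightarrow>
    l2_inner M u (\<lambda>x. f x - g x) = l2_inner M u f - l2_inner M u g"
  by (simp add: l2_inner_commute[of M u] l2_inner_diff_left)

lemma l2_inner_sum_left:
  assumes "\<And>i. i \<in> I \<Longrightarrow> f i \<in> L2 M" "u \<in> L2 M"
  shows "l2_inner M (\<lambda>x. \<Sum>i\<in>I. f i x) u = (\<Sum>i\<in>I. l2_inner M (f i) u)"
  using assms
  by (induction I rule: infinite_finite_induct)
     (auto simp: l2_inner_zero_left l2_inner_add_left L2_intros)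

lemma l2_inner_lincomb_sum_left:
  assumes "\<And>i. i \<in> I \<Longrightarrow> f i \<in> L2 M" "u \<in> L2 M"
  shows "l2_inner M (\<lambda>x. \<Sum>i\<in>I. c i * f i x) u = (\<Sum>i\<in>I. c i * l2_inner M (f i) u)"
  using assms
  by (subst l2_inner_sum_left) (auto simp: l2_inner_scale_left L2_intros)

lemma l2_inner_self_nonneg: "0 \<le> l2_inner M f f"
  by (simp add: l2_inner_def)

lemma l2_norm_nonneg: "0 \<le> l2_norm M f"
  by (simp add: l2_norm_def l2_inner_self_nonneg)

lemma l2_norm_square: "(l2_norm M f)\<^sup>2 = l2_inner M f f"
  by (simp add: l2_norm_def l2_inner_self_nonneg)

lemma l2_inner_diff_diff:
  assumes "f \<in> L2 M" "g \<in> L2 M"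
  shows "l2_inner M (\<lambda>x. f x - g x) (\<lambda>x. f x - g x) =
    l2_inner M f f - 2 * l2_inner M f g + l2_inner M g g"
  using assms
  by (simp add: l2_inner_diff_left l2_inner_diff_right L2_diff l2_inner_commute[of M g f])

lemma l2_Cauchy_Schwarz:
  assumes "f \<in> L2 M" "g \<in> L2 M"
  shows "(l2_inner M f g)\<^sup>2 \<le> l2_inner M f f * l2_inner M g g"
proof -
  let ?A = "l2_inner M f f" and ?B = "l2_inner M f g" and ?C = "l2_inner M g g"
  have q: "0 \<le> t\<^sup>2 * ?A - 2 * t * s * ?B + s\<^sup>2 * ?C" for t s
    using l2_inner_self_nonneg[of M "\<lambda>x. t * f x - s * g x"] assms
    by (simp add: l2_inner_diff_diff L2_scale l2_inner_scale_left l2_inner_scale_right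
        power2_eq_square algebra_simps)
  show ?thesis
  proof (cases "?C = 0")
    case True
    have "?B = 0"
    proof (rule ccontr)
      assume B: "?B \<noteq> 0"
      have "0 \<le> ?A - 2 * ((?A + 1) / (2 * ?B)) * ?B"
        using q[of 1 "(?A + 1) / (2 * ?B)"] True by simp
      then show False using B by simp
    qed
    then show ?thesis using True by simp
  next
    case False
    then have "?C > 0" using l2_inner_self_nonneg[of M g] by simp
    moreover have "0 \<le> ?C * (?A * ?C - ?B\<^sup>2)"
      using q[of ?C ?B] by (simp add: power2_eq_square algebra_simps)
    ultimately show ?thesis by (simp add: zero_le_mult_iff)
  qed
qed

lemma l2_inner_abs_le:
  assumes "f \<in> L2 M" "g \<in> L2 M"
  shows "\<bar>l2_inner M f g\<bar> \<le> l2_norm M f * l2_norm M g"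
proof (rule abs_le_square_iff[THEN iffD2, of _ "l2_norm M f * l2_norm M g", THEN order_trans])
  show "(l2_inner M f g)\<^sup>2 \<le> (l2_norm M f * l2_norm M g)\<^sup>2"
    using l2_Cauchy_Schwarz[OF assms] by (simp add: power_mult_distrib l2_norm_square)
  show "\<bar>l2_norm M f * l2_norm M g\<bar> \<le> l2_norm M f * l2_norm M g"
    by (simp add: l2_norm_nonneg)
qed

lemma l2_norm_cong_AE:
  "f \<in> L2 M \<Longrightarrow> f' \<in> L2 M \<Longrightarrow> ae_eq M f f' \<Longrightarrow> l2_norm M f = l2_norm M f'"
  unfolding l2_norm_def by (subst l2_inner_cong_AE) auto

lemma l2_tendsto_inner:
  assumes "\<And>n. s n \<in> L2 M" "f \<in> L2 M" "g \<in> L2 M"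
    and lim: "(\<lambda>n. l2_norm M (\<lambda>x. f x - s n x)) \<longlonglongrightarrow> 0"
  shows "(\<lambda>n. l2_inner M (s n) g) \<longlonglongrightarrow> l2_inner M f g"
proof (rule LIM_zero_cancel, rule Lim_null_comparison)
  show "\<forall>\<^sub>F n in sequentially. norm (l2_inner M (s n) g - l2_inner M f g)
      \<le> l2_norm M (\<lambda>x. f x - s n x) * l2_norm M g"
    using l2_inner_abs_le[OF L2_diff[OF assms(2,1)] assms(3)] assms
    by (simp add: l2_inner_diff_left abs_minus_commute)
  show "(\<lambda>n. l2_norm M (\<lambda>x. f x - s n x) * l2_norm M g) \<longlonglongrightarrow> 0"
    using tendsto_mult_right[OF lim, of "l2_norm M g"] by simp
qed

lemma l2_span_subspace:
  assumes "S \<subseteq> L2 M" "u \<in> l2_span M S" "v \<in> l2_span M S"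
  shows "(\<lambda>x. a * u x + b * v x) \<in> l2_span M S"
proof -
  from assms obtain F c G e where F: "finite F" "F \<subseteq> S" "ae_eq M u (\<lambda>x. \<Sum>g\<in>F. c g * g x)"
    and G: "finite G" "G \<subseteq> S" "ae_eq M v (\<lambda>x. \<Sum>g\<in>G. e g * g x)"
    unfolding l2_span_def by blast
  let ?c = "\<lambda>g. if g \<in> F then c g else 0" and ?e = "\<lambda>g. if g \<in> G then e g else 0"
  have 1: "(\<Sum>g\<in>F. c g * g x) = (\<Sum>g\<in>F\<union>G. ?c g * g x)" for x
    using F(1) G(1) by (intro sum.mono_neutral_cong_left) auto
  have 2: "(\<Sum>g\<in>G. e g * g x) = (\<Sum>g\<in>F\<union>G. ?e g * g x)" for x
    using F(1) G(1) by (intro sum.mono_neutral_cong_left) auto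
  have "ae_eq M (\<lambda>x. a * u x + b * v x) (\<lambda>x. \<Sum>g\<in>F\<union>G. (a * ?c g + b * ?e g) * g x)"
    using F(3) G(3)
  proof eventually_elim
    case (elim x)
    have "(\<Sum>g\<in>F\<union>G. (a * ?c g + b * ?e g) * g x) =
        a * (\<Sum>g\<in>F\<union>G. ?c g * g x) + b * (\<Sum>g\<in>F\<union>G. ?e g * g x)"
      by (simp only: distrib_right sum.distrib sum_distrib_left mult.assoc)
    then show ?case using elim 1 2 by simp
  qed
  moreover have "(\<lambda>x. a * u x + b * v x) \<in> L2 M"
    using assms by (auto simp: l2_span_def intro: L2_lincomb)
  moreover have "finite (F \<union> G)" "F \<union> G \<subseteq> S" using F G by auto
  ultimately show ?thesis 
    unfolding l2_span_def mem_Collect_eq 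
    by (intro conjI exI[of _ "F \<union> G"] exI[of _ "\<lambda>g. a * ?c g + b * ?e g"]) simp_all
qed

lemma l2_span_cong_AE:
  assumes "f \<in> L2 M" "ae_eq M f g" "g \<in> l2_span M S"
  shows "f \<in> l2_span M S"
proof -
  from assms(3) obtain F c where F: "finite F" "F \<subseteq> S" and ae: "ae_eq M g (\<lambda>x. \<Sum>u\<in>F. c u * u x)"
    unfolding l2_span_def by blast
  have "ae_eq M f (\<lambda>x. \<Sum>u\<in>F. c u * u x)"
    using assms(2) ae by eventually_elim simp
  with F assms(1) show ?thesis unfolding l2_span_def by blast
qed

lemma l2_span_base:
  assumes "S \<subseteq> L2 M" "g \<in> S"
  shows "g \<in> l2_span M S"
  using assms unfolding l2_span_def
  by (auto intro!: exI[of _ "{g}"] exI[of _ "\<lambda>_. 1"])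

lemma l2_span_sum:
  assumes "S \<subseteq> L2 M" "\<And>i. i \<in> I \<Longrightarrow> u i \<in> l2_span M S"
  shows "(\<lambda>x. \<Sum>i\<in>I. c i * u i x) \<in> l2_span M S"
  using assms(2)
proof (induction I rule: infinite_finite_induct)
  case (insert i I)
  then have "(\<lambda>x. c i * u i x + 1 * (\<Sum>j\<in>I. c j * u j x)) \<in> l2_span M S"
    by (intro l2_span_subspace[OF assms(1)]) auto
  then show ?case using insert by simp
next
  case empty
  show ?case by (auto simp: l2_span_def L2_zero intro!: exI[of _ "{}"])
next
  case (infinite I)
  then show ?case by (auto simp: l2_span_def L2_zero intro!: exI[of _ "{}"])
qed

lemma l2_complete_orthonormal_total:
  assumes S: "l2_complete_orthonormal M S" and u: "u \<in> L2 M"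
    and orth: "\<And>g. g \<in> S \<Longrightarrow> l2_inner M u g = 0"
  shows "l2_inner M u u = 0"
proof (rule ccontr)
  assume "l2_inner M u u \<noteq> 0"
  then have pos: "0 < l2_norm M u"
    using l2_inner_self_nonneg[of M u] by (simp add: l2_norm_def)
  have SL2: "S \<subseteq> L2 M" using S by (simp add: l2_complete_orthonormal_def l2_orthonormal_def)
  obtain g where g: "g \<in> l2_span M S" and near: "l2_norm M (\<lambda>x. u x - g x) < l2_norm M u"
    using S u pos unfolding l2_complete_orthonormal_def l2_dense_def by blast
  obtain F c where gL2: "g \<in> L2 M" and F: "F \<subseteq> S" and ae: "ae_eq M g (\<lambda>x. \<Sum>v\<in>F. c v * v x)"
    using g unfolding l2_span_def by blast
  have FL2: "v \<in> L2 M" if "v \<in> F" for v using that F SL2 by blast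
  have "l2_inner M g u = l2_inner M (\<lambda>x. \<Sum>v\<in>F. c v * v x) u"
    using ae gL2 u FL2 by (intro l2_inner_cong_AE L2_sum L2_scale) auto
  also have "\<dots> = (\<Sum>v\<in>F. c v * l2_inner M v u)"
    using FL2 u by (rule l2_inner_lincomb_sum_left)
  also have "\<dots> = (\<Sum>v\<in>F. 0)"
  proof (rule sum.cong[OF refl])
    fix v assume "v \<in> F"
    then show "c v * l2_inner M v u = 0" using F orth[of v] l2_inner_commute[of M v u] by auto
  qed
  finally have "l2_inner M u g = 0" by (simp add: l2_inner_commute[of M u g])
  then have "(l2_norm M (\<lambda>x. u x - g x))\<^sup>2 = l2_inner M u u + l2_inner M g g"
    by (simp add: l2_norm_square l2_inner_diff_diff u gL2)
  then have "(l2_norm M u)\<^sup>2 \<le> (l2_norm M (\<lambda>x. u x - g x))\<^sup>2"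
    using l2_inner_self_nonneg[of M g] by (simp add: l2_norm_square)
  then have "l2_norm M u \<le> l2_norm M (\<lambda>x. u x - g x)"
    by (rule power2_le_imp_le) (rule l2_norm_nonneg)
  then show False using near by simp
qed

section \<open>The Riesz--Fischer theorem\<close>

lemma l2_inner_orthonormal_sum:
  fixes h :: "'i \<Rightarrow> 'a \<Rightarrow> real"
  assumes "finite I" "\<And>i. i \<in> I \<Longrightarrow> h i \<in> L2 M"
    and "\<And>i j. i \<in> I \<Longrightarrow> j \<in> I \<Longrightarrow> l2_inner M (h i) (h j) = (if i = j then 1 else 0)"
  shows "l2_inner M (\<lambda>x. \<Sum>i\<in>I. c i * h i x) (\<lambda>x. \<Sum>i\<in>I. c i * h i x) = (\<Sum>i\<in>I. (c i)\<^sup>2)"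
proof -
  have L: "(\<lambda>x. \<Sum>i\<in>I. c i * h i x) \<in> L2 M" using assms by (intro L2_intros)
  have "l2_inner M (h j) (\<lambda>x. \<Sum>i\<in>I. c i * h i x) = c j" if "j \<in> I" for j
    using assms that
    by (subst l2_inner_commute, subst l2_inner_lincomb_sum_left)
       (auto simp: if_distrib[of "\<lambda>t. _ * t"] cong: if_cong)
  then show ?thesis
    using assms L by (subst l2_inner_lincomb_sum_left) (auto simp: power2_eq_square)
qed

text \<open>
  The partial sums \<open>s n\<close> are Cauchy in \<open>L\<^sup>2\<close>, because \<open>\<parallel>s m - s n\<parallel>\<^sup>2\<close> is a block of the convergent
  series \<open>\<Sum>a\<^sub>k\<^sup>2\<close>.  Along a subsequence whose consecutive distances are at most \<open>(1/8)^j\<close> in square they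
  converge almost everywhere, and Fatou's lemma bounds the distance of \<open>s n\<close> to this pointwise limit by
  the tail of the same series.
\<close>

lemma Riesz_Fischer:
  fixes h :: "nat \<Rightarrow> 'a \<Rightarrow> real"
  assumes h: "\<And>k. h k \<in> L2 M"
    and on: "\<And>j k. l2_inner M (h j) (h k) = (if j = k then 1 else 0)"
    and a: "summable (\<lambda>k. (a k)\<^sup>2)"
  shows "\<exists>f. l2_sums M (\<lambda>k x. a k * h k x) f"
proof -
  define s where "s n x = (\<Sum>k<n. a k * h k x)" for n x
  have sL2: "s n \<in> L2 M" for n
    unfolding s_def using h by (intro L2_intros)
  have [measurable]: "s n \<in> borel_measurable M" for n
    using sL2 by (rule L2_measurable)
  define E where "E m n = l2_inner M (\<lambda>x. s m x - s n x) (\<lambda>x. s m x - s n x)" for m n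
  have E_sym: "E m n = E n m" for m n
    unfolding E_def l2_inner_def by (rule Bochner_Integration.integral_cong) (auto simp: algebra_simps)
  have E_eq: "E m n = (\<Sum>k\<in>{n..<m}. (a k)\<^sup>2)" if "n \<le> m" for m n
  proof -
    have "s m x - s n x = (\<Sum>k\<in>{n..<m}. a k * h k x)" for x
      using sum_diff_nat_ivl[of 0 n m "\<lambda>k. a k * h k x"] that by (simp add: s_def atLeast0LessThan)
    then have "E m n = l2_inner M (\<lambda>x. \<Sum>k\<in>{n..<m}. a k * h k x) (\<lambda>x. \<Sum>k\<in>{n..<m}. a k * h k x)"
      by (simp add: E_def)
    also have "\<dots> = (\<Sum>k\<in>{n..<m}. (a k)\<^sup>2)"
      using h on by (intro l2_inner_orthonormal_sum) auto
    finally show ?thesis .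
  qed
  have "\<exists>N. \<forall>m\<ge>N. \<forall>n. (\<Sum>k\<in>{m..<n}. (a k)\<^sup>2) < (1/8)^j" for j :: nat
  proof -
    have "\<exists>N. \<forall>m\<ge>N. \<forall>n. norm (\<Sum>k\<in>{m..<n}. (a k)\<^sup>2) < (1/8)^j"
      using a unfolding summable_Cauchy by (meson zero_less_divide_1_iff zero_less_numeral zero_less_power)
    then show ?thesis by (auto simp: sum_nonneg)
  qed
  then obtain N where N: "\<And>j m n. m \<ge> N j \<Longrightarrow> (\<Sum>k\<in>{m..<n}. (a k)\<^sup>2) < (1/8)^j"
    by metis
  have E_small: "E m n < (1/8)^j" if "m \<ge> N j" "n \<ge> N j" for m n j
    using that N[of j m n] N[of j n m] E_eq[of m n] E_eq[of n m] E_sym[of m n] by (cases "m \<le> n") auto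
  \<comment> \<open>Summing the thresholds makes \<open>r j\<close> exceed all of \<open>N 0, \<dots>, N j\<close>.\<close>
  define r where "r j = (\<Sum>i\<le>j. N i)" for j
  have r: "r j \<ge> N i" if "i \<le> j" for i j
    unfolding r_def using that by (intro member_le_sum) auto
  define D where "D j x = s (r (Suc j)) x - s (r j) x" for j x
  have [measurable]: "D j \<in> borel_measurable M" for j
    unfolding D_def by measurable
  have DL2: "D j \<in> L2 M" for j
    unfolding D_def by (intro L2_intros sL2)
  have D2: "(\<integral>\<^sup>+ x. ennreal (4^j * (D j x)\<^sup>2) \<partial>M) \<le> ennreal ((1/2)^j)" for j
  proof -
    have "(\<integral>\<^sup>+ x. ennreal (4^j * (D j x)\<^sup>2) \<partial>M) = ennreal (LINT x|M. 4^j * (D j x)\<^sup>2)"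
      using L2_integrable_square[OF DL2] by (intro nn_integral_eq_integral) auto
    also have "(LINT x|M. 4^j * (D j x)\<^sup>2) = 4^j * E (r (Suc j)) (r j)"
      by (simp add: E_def l2_inner_def D_def power2_eq_square)
    also have "\<dots> \<le> 4^j * (1/8)^j"
      using E_small[of j "r (Suc j)" "r j"] r[of j j] r[of j "Suc j"] by simp
    also have "\<dots> = (1/2 :: real)^j" by (simp flip: power_mult_distrib)
    finally show ?thesis by (simp add: ennreal_leI)
  qed
  \<comment> \<open>With the weight \<open>4^j\<close>, finiteness of the sum at \<open>x\<close> makes \<open>D j x\<close> decay like \<open>(1/2)^j\<close>.\<close>
  have "(\<integral>\<^sup>+ x. (\<Sum>j. ennreal (4^j * (D j x)\<^sup>2)) \<partial>M) = (\<Sum>j. \<integral>\<^sup>+ x. ennreal (4^j * (D j x)\<^sup>2) \<partial>M)"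
    by (intro nn_integral_suminf) measurable
  also have "\<dots> \<le> (\<Sum>j. ennreal ((1/2)^j))"
    by (intro suminf_le D2) auto
  also have "\<dots> = ennreal (\<Sum>j. (1/2)^j)"
    by (rule suminf_ennreal2) (auto intro: summable_geometric)
  finally have "(\<integral>\<^sup>+ x. (\<Sum>j. ennreal (4^j * (D j x)\<^sup>2)) \<partial>M) \<noteq> \<infinity>"
    by (auto simp: top_unique)
  then have AE_fin: "AE x in M. (\<Sum>j. ennreal (4^j * (D j x)\<^sup>2)) \<noteq> \<infinity>"
    by (intro nn_integral_PInf_AE) measurable
  have conv: "AE x in M. convergent (\<lambda>j. s (r j) x)"
    using AE_fin
  proof eventually_elim
    case (elim x)
    define B where "B = enn2real (\<Sum>j. ennreal (4^j * (D j x)\<^sup>2))"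
    have B: "(\<Sum>j. ennreal (4^j * (D j x)\<^sup>2)) = ennreal B" "B \<ge> 0"
      unfolding B_def using elim by (simp_all only: ennreal_enn2real less_top infinity_ennreal_def enn2real_nonneg)
    have "\<bar>D j x\<bar> \<le> sqrt B * (1/2)^j" for j
    proof -
      have "ennreal (4^j * (D j x)\<^sup>2) \<le> (\<Sum>j. ennreal (4^j * (D j x)\<^sup>2))"
        using sum_le_suminf[OF summableI, of "{j}" "\<lambda>j. ennreal (4^j * (D j x)\<^sup>2)"]
        by (simp only: sum.insert sum.empty finite.emptyI finite.insertI empty_iff not_False_eq_True add_0_right zero_le simp_thms HOL.implies_True_equals)
      then have "4^j * (D j x)\<^sup>2 \<le> B"
        unfolding B(1) using B(2) by (rule ennreal_le_iff[THEN iffD1, rotated])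
      moreover have "(2^j * \<bar>D j x\<bar>)\<^sup>2 = 4^j * (D j x)\<^sup>2"
        using power_mult_distrib[of "2::real" 2 j] by (simp add: power2_eq_square)
      ultimately have "2^j * \<bar>D j x\<bar> \<le> sqrt B"
        by (intro real_le_rsqrt) simp
      then have "2^j * \<bar>D j x\<bar> * (1/2)^j \<le> sqrt B * (1/2)^j"
        by (rule mult_right_mono) simp
      then show ?thesis by (simp add: power_divide)
    qed
    moreover have "summable (\<lambda>j. sqrt B * (1/2)^j)"
      by (intro summable_mult summable_geometric) simp
    ultimately have "summable (\<lambda>j. D j x)"
      by (intro summable_comparison_test'[of "\<lambda>j. sqrt B * (1/2)^j" 0 "\<lambda>j. D j x"]) simp_all
    then have "convergent (\<lambda>n. \<Sum>j<n. D j x)"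
      by (simp add: summable_iff_convergent)
    then have "convergent (\<lambda>n. (\<Sum>j<n. D j x) + s (r 0) x)"
      by (simp only: convergent_add_const_right_iff)
    moreover have "(\<lambda>n. (\<Sum>j<n. D j x) + s (r 0) x) = (\<lambda>n. s (r n) x)"
      using sum_lessThan_telescope[of "\<lambda>j. s (r j) x"] by (simp add: D_def)
    ultimately show ?case by (simp only:)
  qed
  define f where "f x = lim (\<lambda>j. s (r j) x)" for x
  have [measurable]: "f \<in> borel_measurable M"
    unfolding f_def by (intro borel_measurable_lim_metric) measurable
  have bound: "(\<integral>\<^sup>+ x. ennreal ((f x - s n x)\<^sup>2) \<partial>M) \<le> ennreal ((1/8)^J)" if "n \<ge> N J" for n J
  proof -
    have "(\<integral>\<^sup>+ x. ennreal ((f x - s n x)\<^sup>2) \<partial>M) =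
        (\<integral>\<^sup>+ x. liminf (\<lambda>j. ennreal ((s (r j) x - s n x)\<^sup>2)) \<partial>M)"
    proof (rule nn_integral_cong_AE, use conv in eventually_elim)
      case (elim x)
      then have "(\<lambda>j. s (r j) x) \<longlonglongrightarrow> f x"
        unfolding f_def by (simp add: convergent_LIMSEQ_iff)
      then have "(\<lambda>j. ennreal ((s (r j) x - s n x)\<^sup>2)) \<longlonglongrightarrow> ennreal ((f x - s n x)\<^sup>2)"
        by (intro tendsto_intros)
      from lim_imp_Liminf[OF sequentially_bot this] show ?case ..
    qed
    also have "\<dots> \<le> liminf (\<lambda>j. \<integral>\<^sup>+ x. ennreal ((s (r j) x - s n x)\<^sup>2) \<partial>M)"
      by (rule nn_integral_liminf) simp
    also have "\<dots> \<le> limsup (\<lambda>j. \<integral>\<^sup>+ x. ennreal ((s (r j) x - s n x)\<^sup>2) \<partial>M)"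
      by (rule Liminf_le_Limsup) simp
    also have "\<dots> \<le> ennreal ((1/8)^J)"
    proof (rule Limsup_bounded, rule eventually_sequentiallyI[of J])
      fix j assume "j \<ge> J"
      then have "E (r j) n \<le> (1/8)^J" using E_small[of J "r j" n] r[of J j] that by simp
      moreover have "(\<integral>\<^sup>+ x. ennreal ((s (r j) x - s n x)\<^sup>2) \<partial>M) = ennreal (E (r j) n)"
        unfolding E_def l2_inner_def power2_eq_square
        using L2_integrable_mult[OF L2_diff L2_diff, OF sL2 sL2 sL2 sL2]
        by (intro nn_integral_eq_integral) auto
      ultimately show "(\<integral>\<^sup>+ x. ennreal ((s (r j) x - s n x)\<^sup>2) \<partial>M) \<le> ennreal ((1/8)^J)"
        by (simp add: ennreal_leI)
    qed
    finally show ?thesis .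
  qed
  \<comment> \<open>Membership of \<open>f\<close> in \<open>L2 M\<close> comes from the bound too: \<open>f - s n\<close> has finite square integral.\<close>
  have diff_L2: "(\<lambda>x. f x - s n x) \<in> L2 M" if "n \<ge> N J" for n J
    unfolding L2_def using bound[OF that]
    by (auto intro!: integrableI_bounded simp: le_less_trans[OF _ ennreal_less_top])
  then have fL2: "f \<in> L2 M"
    using L2_add[OF diff_L2[of 0 "N 0"] sL2[of "N 0"]] by simp
  have norm_small: "l2_norm M (\<lambda>x. f x - s n x) \<le> sqrt ((1/8)^J)" if "n \<ge> N J" for n J
  proof -
    have "ennreal (l2_inner M (\<lambda>x. f x - s n x) (\<lambda>x. f x - s n x)) =
      (\<integral>\<^sup>+ x. ennreal ((f x - s n x)\<^sup>2) \<partial>M)"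
      unfolding l2_inner_def power2_eq_square
      using L2_integrable_mult[OF L2_diff L2_diff, OF fL2 sL2 fL2 sL2]
      by (intro nn_integral_eq_integral[symmetric]) auto
    also have "\<dots> \<le> ennreal ((1/8)^J)" by (rule bound[OF that])
    finally show ?thesis by (subst (asm) ennreal_le_iff) (simp_all add: l2_norm_def)
  qed
  have "(\<lambda>n. l2_norm M (\<lambda>x. f x - s n x)) \<longlonglongrightarrow> 0"
  proof (rule LIMSEQ_I)
    fix e :: real assume "e > 0"
    then obtain J where J: "(1/8)^J < e\<^sup>2"
      using real_arch_pow_inv[of "e\<^sup>2" "1/8"] by auto
    have "l2_norm M (\<lambda>x. f x - s n x) < e" if "n \<ge> N J" for n
      using norm_small[OF that] real_sqrt_less_mono[OF J] \<open>e > 0\<close> by simp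
    then show "\<exists>no. \<forall>n\<ge>no. norm (l2_norm M (\<lambda>x. f x - s n x) - 0) < e"
      by (auto simp: l2_norm_nonneg)
  qed
  then have "l2_sums M (\<lambda>k x. a k * h k x) f"
    unfolding l2_sums_def s_def using fL2 L2_scale[OF h] by blast
  then show ?thesis by blast
qed

section \<open>Expansion in an orthonormal basis\<close>

text \<open>
  Completeness of the orthonormal sequence is assumed as totality (only the zero function is orthogonal
  to it), which is what can be checked for tensor products; density of the span is derived from it.
\<close>

locale l2_basis =
  fixes M :: "'a measure" and h :: "nat \<Rightarrow> 'a \<Rightarrow> real"
  assumes h_L2: "h k \<in> L2 M"
    and h_orthonormal: "l2_inner M (h j) (h k) = (if j = k then 1 else 0)"
    and h_total: "f \<in> L2 M \<Longrightarrow> (\<And>k. l2_inner M f (h k) = 0) \<Longrightarrow> ae_eq M f (\<lambda>_. 0)"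
begin

definition coef :: "('a \<Rightarrow> real) \<Rightarrow> nat \<Rightarrow> real" where
  "coef f k = l2_inner M f (h k)"

lemma coef_cong_AE:
  assumes "f \<in> L2 M" "g \<in> L2 M" "ae_eq M f g"
  shows "coef f k = coef g k"
  unfolding coef_def using assms h_L2 by (intro l2_inner_cong_AE) auto

lemma coef_lincomb:
  "f \<in> L2 M \<Longrightarrow> g \<in> L2 M \<Longrightarrow> coef (\<lambda>x. a * f x + b * g x) k = a * coef f k + b * coef g k"
  unfolding coef_def by (rule l2_inner_lincomb_left) (auto simp: h_L2)

lemma coef_diff:
  "f \<in> L2 M \<Longrightarrow> g \<in> L2 M \<Longrightarrow> coef (\<lambda>x. f x - g x) k = coef f k - coef g k"
  using coef_lincomb[of f g 1 "-1"] by simp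

lemma coef_scale: "coef (\<lambda>x. a * f x) k = a * coef f k"
  by (simp add: coef_def l2_inner_scale_left)

lemma coef_uminus: "coef (\<lambda>x. - f x) k = - coef f k"
  by (simp add: coef_def l2_inner_uminus_left)

lemma coef_zero: "coef (\<lambda>_. 0) k = 0"
  by (simp add: coef_def l2_inner_zero_left)

lemma coef_basis: "coef (h j) k = (if j = k then 1 else 0)"
  by (simp add: coef_def h_orthonormal)

lemma coef_eqI:
  assumes "f \<in> L2 M" "g \<in> L2 M" "\<And>k. coef f k = coef g k"
  shows "ae_eq M f g"
proof -
  have "ae_eq M (\<lambda>x. f x - g x) (\<lambda>_. 0)"
    using assms by (intro h_total L2_diff) (simp_all add: coef_diff flip: coef_def)
  then show ?thesis by simp
qed

lemma partial_sum_L2: "(\<lambda>x. \<Sum>k<n. c k * h k x) \<in> L2 M"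
  by (intro L2_sum L2_scale h_L2)

lemma coef_partial_sum: "coef (\<lambda>x. \<Sum>k<n. c k * h k x) j = (if j < n then c j else 0)"
  unfolding coef_def
  by (subst l2_inner_lincomb_sum_left)
     (auto simp: h_L2 h_orthonormal if_distrib[of "\<lambda>t. _ * t"] cong: if_cong)

lemma l2_sums_imp_coef:
  assumes "l2_sums M (\<lambda>k x. c k * h k x) f"
  shows "coef f k = c k"
proof -
  have "(\<lambda>n. coef (\<lambda>x. \<Sum>j<n. c j * h j x) k) \<longlonglongrightarrow> coef f k"
    using assms unfolding coef_def l2_sums_def
    by (intro l2_tendsto_inner partial_sum_L2 h_L2) auto
  moreover have "(\<lambda>n. coef (\<lambda>x. \<Sum>j<n. c j * h j x) k) \<longlonglongrightarrow> c k"
    by (rule tendsto_eventually, rule eventually_sequentiallyI[of "Suc k"])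
       (simp add: coef_partial_sum)
  ultimately show ?thesis by (rule LIMSEQ_unique)
qed

lemma Bessel:
  assumes "f \<in> L2 M"
  shows "summable (\<lambda>k. (coef f k)\<^sup>2)"
proof (rule summableI_nonneg_bounded)
  fix n
  let ?s = "\<lambda>x. \<Sum>k<n. coef f k * h k x"
  have s: "?s \<in> L2 M" by (rule partial_sum_L2)
  have "l2_inner M ?s f = (\<Sum>k<n. (coef f k)\<^sup>2)"
    using assms by (subst l2_inner_lincomb_sum_left)
      (auto simp: h_L2 coef_def power2_eq_square l2_inner_commute[of M f "h k" for k])
  moreover have "l2_inner M ?s ?s = (\<Sum>k<n. (coef f k)\<^sup>2)"
    by (rule l2_inner_orthonormal_sum) (auto simp: h_L2 h_orthonormal)
  ultimately show "(\<Sum>k<n. (coef f k)\<^sup>2) \<le> l2_inner M f f"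
    using l2_inner_self_nonneg[of M "\<lambda>x. f x - ?s x"] l2_inner_diff_diff[OF assms s]
    by (simp add: l2_inner_commute[of M f ?s])
qed simp

lemma ex_coef:
  assumes "summable (\<lambda>k. (a k)\<^sup>2)"
  shows "\<exists>f\<in>L2 M. \<forall>k. coef f k = a k"
  using Riesz_Fischer[of h M a, OF h_L2 h_orthonormal assms] l2_sums_imp_coef
  unfolding l2_sums_def by blast

text \<open>
  Totality turns Bessel's inequality into an expansion: by Riesz--Fischer the Fourier series of \<open>f\<close> has
  some sum \<open>g\<close>, and \<open>f - g\<close> is orthogonal to every basis element.
\<close>

lemma l2_sums_coef:
  assumes f: "f \<in> L2 M"
  shows "l2_sums M (\<lambda>k x. coef f k * h k x) f"
proof -
  obtain g where g: "l2_sums M (\<lambda>k x. coef f k * h k x) g"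
    using Riesz_Fischer[of h M "coef f", OF h_L2 h_orthonormal Bessel[OF f]] by blast
  then have gL2: "g \<in> L2 M" by (simp add: l2_sums_def)
  have ae: "ae_eq M f g"
    using l2_sums_imp_coef[OF g] by (intro coef_eqI f gL2) simp
  have "l2_norm M (\<lambda>x. f x - (\<Sum>k<n. coef f k * h k x)) =
      l2_norm M (\<lambda>x. g x - (\<Sum>k<n. coef f k * h k x))" for n
    using ae by (intro l2_norm_cong_AE L2_diff f gL2 partial_sum_L2) auto
  then show ?thesis using g f by (simp add: l2_sums_def)
qed

text \<open>
  With this equivalence the existentially quantified coefficients in \<open>diag_dom\<close> and \<open>diag_op\<close> become
  Fourier coefficients, and \<open>coef\<close> identifies \<open>L\<^sup>2\<close> modulo null functions with the sequence space \<open>\<ell>\<^sup>2\<close>.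
\<close>

lemma l2_sums_basis_iff:
  "l2_sums M (\<lambda>k x. c k * h k x) f \<longleftrightarrow> f \<in> L2 M \<and> c = coef f"
  using l2_sums_imp_coef[of c f] l2_sums_coef[of f] by (auto simp: l2_sums_def fun_eq_iff)

lemma Parseval:
  assumes f: "f \<in> L2 M" and g: "g \<in> L2 M"
  shows "(\<lambda>k. coef f k * coef g k) sums l2_inner M f g"
proof -
  have "(\<lambda>n. l2_inner M (\<lambda>x. \<Sum>k<n. coef f k * h k x) g) \<longlonglongrightarrow> l2_inner M f g"
    using l2_sums_coef[OF f] f g
    by (intro l2_tendsto_inner partial_sum_L2) (auto simp: l2_sums_def)
  moreover have "l2_inner M (\<lambda>x. \<Sum>k<n. coef f k * h k x) g = (\<Sum>k<n. coef f k * coef g k)" for n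
    using g by (subst l2_inner_lincomb_sum_left) (auto simp: h_L2 coef_def l2_inner_commute[of M g "h k" for k])
  ultimately show ?thesis by (simp add: sums_def)
qed

lemma partial_sum_span: "(\<lambda>x. \<Sum>k<n. c k * h k x) \<in> l2_span M (range h)"
  by (intro l2_span_sum l2_span_base) (auto simp: h_L2)

lemma l2_dense_superset_span:
  assumes "l2_span M (range h) \<subseteq> D" "D \<subseteq> L2 M"
  shows "l2_dense M D"
  unfolding l2_dense_def
proof (intro conjI ballI allI impI)
  fix f e assume "f \<in> L2 M" "(e::real) > 0"
  then have "(\<lambda>n. l2_norm M (\<lambda>x. f x - (\<Sum>k<n. coef f k * h k x))) \<longlonglongrightarrow> 0"
    using l2_sums_coef by (simp add: l2_sums_def)
  from LIMSEQ_D[OF this \<open>e > 0\<close>] obtain n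
    where "l2_norm M (\<lambda>x. f x - (\<Sum>k<n. coef f k * h k x)) < e"
    by (auto simp: l2_norm_nonneg)
  then show "\<exists>g\<in>D. l2_norm M (\<lambda>x. f x - g x) < e"
    using partial_sum_span[of "coef f" n] assms(1) by (intro bexI[of _ "\<lambda>x. \<Sum>k<n. coef f k * h k x"]) auto
qed (rule assms)

lemma l2_complete_orthonormal_range: "l2_complete_orthonormal M (range h)"
proof -
  have "l2_dense M (l2_span M (range h))"
    by (intro l2_dense_superset_span) (auto simp: l2_span_def)
  moreover have "h j = h k \<longleftrightarrow> j = k" for j k
    using h_orthonormal[of j k] h_orthonormal[of k k] by (auto split: if_splits)
  ultimately show ?thesis
    by (auto simp: l2_complete_orthonormal_def l2_orthonormal_def h_L2 h_orthonormal)
qed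

end

section \<open>Diagonal operators with non-negative eigenvalues\<close>

lemma square_le_square: "0 \<le> x \<Longrightarrow> x \<le> y \<Longrightarrow> x\<^sup>2 * t\<^sup>2 \<le> y\<^sup>2 * t\<^sup>2" for x y t :: real
  by (intro mult_right_mono power_mono) auto

text \<open>
  In terms of coefficients the operator \<open>L\<close> is multiplication by \<open>- \<alpha> k\<close>, so each property below is a
  statement about sequences: the resolvent divides by \<open>1 + \<alpha> k\<close>, an eigenvector for \<open>\<mu>\<close> has
  coefficients only where \<open>\<alpha> k = \<mu>\<close>, and inner products are sums by Parseval's identity.
\<close>

locale diagonal_operator = l2_basis M h for M :: "'a measure" and h +
  fixes \<alpha> :: "nat \<Rightarrow> real"
  assumes \<alpha>_nonneg: "0 \<le> \<alpha> k"
begin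

abbreviation "D \<equiv> diag_dom M h \<alpha>"
abbreviation "L \<equiv> diag_op M h \<alpha>"

lemma dom_iff: "v \<in> D \<longleftrightarrow> v \<in> L2 M \<and> summable (\<lambda>k. (coef v k)\<^sup>2 * (\<alpha> k)\<^sup>2)"
  by (auto simp: diag_dom_def l2_sums_basis_iff)

lemma dom_L2: "v \<in> D \<Longrightarrow> v \<in> L2 M"
  by (simp add: dom_iff)

lemma op_L2_coef:
  assumes "v \<in> D"
  shows "L v \<in> L2 M \<and> (\<forall>k. coef (L v) k = - \<alpha> k * coef v k)"
proof -
  let ?P = "\<lambda>w. w \<in> L2 M \<and> (\<exists>c. l2_sums M (\<lambda>k x. c k * h k x) v \<and>
        l2_sums M (\<lambda>k x. \<alpha> k * c k * h k x) (\<lambda>x. - w x))"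
  have neq: "a * b = - c \<longleftrightarrow> c = - a * b" for a b c :: real by auto
  have P: "?P w \<longleftrightarrow> w \<in> L2 M \<and> (\<forall>k. coef w k = - \<alpha> k * coef v k)" for w
  proof -
    have "?P w \<longleftrightarrow> w \<in> L2 M \<and> (\<forall>k. \<alpha> k * coef v k = - coef w k)"
      using dom_L2[OF assms] L2_uminus[of w M]
      by (auto simp: l2_sums_basis_iff[of "\<lambda>k. \<alpha> k * _ k"] l2_sums_basis_iff[of _ v] coef_uminus fun_eq_iff)
    also have "\<dots> \<longleftrightarrow> w \<in> L2 M \<and> (\<forall>k. coef w k = - \<alpha> k * coef v k)"
      by (simp add: neq)
    finally show ?thesis .
  qed
  have "summable (\<lambda>k. (- \<alpha> k * coef v k)\<^sup>2)"
    using assms by (simp add: dom_iff power_mult_distrib mult.commute)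
  from ex_coef[OF this] have "\<exists>w. ?P w" unfolding P by blast
  then have "?P (SOME w. ?P w)" by (rule someI_ex)
  then have "?P (L v)" by (simp only: diag_op_def)
  then show ?thesis by (rule P[THEN iffD1])
qed

lemma op_L2: "v \<in> D \<Longrightarrow> L v \<in> L2 M"
  and coef_op: "v \<in> D \<Longrightarrow> coef (L v) k = - \<alpha> k * coef v k"
  using op_L2_coef by auto

lemma basis_in_dom: "h k \<in> D"
proof -
  have "(\<lambda>j. (coef (h k) j)\<^sup>2 * (\<alpha> j)\<^sup>2) = (\<lambda>j. if j = k then (\<alpha> j)\<^sup>2 else 0)"
    by (auto simp: coef_basis)
  then show ?thesis by (simp add: dom_iff h_L2)
qed

lemma lincomb_in_dom:
  assumes "f \<in> D" "g \<in> D"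
  shows "(\<lambda>x. a * f x + b * g x) \<in> D"
proof -
  have "summable (\<lambda>k. 2 * a\<^sup>2 * ((coef f k)\<^sup>2 * (\<alpha> k)\<^sup>2) + 2 * b\<^sup>2 * ((coef g k)\<^sup>2 * (\<alpha> k)\<^sup>2))"
    using assms by (intro summable_add summable_mult) (auto simp: dom_iff)
  moreover have "(a * u + b * v)\<^sup>2 * t\<^sup>2 \<le> 2 * a\<^sup>2 * (u\<^sup>2 * t\<^sup>2) + 2 * b\<^sup>2 * (v\<^sup>2 * t\<^sup>2)" for u v t :: real
  proof -
    have "(a * u + b * v)\<^sup>2 \<le> 2 * (a * u)\<^sup>2 + 2 * (b * v)\<^sup>2"
      using zero_le_power2[of "a * u - b * v"] by (simp add: power2_eq_square algebra_simps)
    from mult_right_mono[OF this, of "t\<^sup>2"] show ?thesis by (simp add: power_mult_distrib algebra_simps)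
  qed
  ultimately have "summable (\<lambda>k. (a * coef f k + b * coef g k)\<^sup>2 * (\<alpha> k)\<^sup>2)"
    by (intro summable_comparison_test'[of _ 0 "\<lambda>k. (a * coef f k + b * coef g k)\<^sup>2 * (\<alpha> k)\<^sup>2"]) simp_all
  then show ?thesis using assms by (simp add: dom_iff L2_lincomb coef_lincomb)
qed

lemma span_subset_dom: "l2_span M (range h) \<subseteq> D"
proof
  fix v assume "v \<in> l2_span M (range h)"
  then obtain F c where v: "v \<in> L2 M" and F: "finite F" "F \<subseteq> range h"
    and ae: "ae_eq M v (\<lambda>x. \<Sum>g\<in>F. c g * g x)" by (auto simp: l2_span_def)
  have "(\<lambda>x. \<Sum>g\<in>F. c g * g x) \<in> D"
    using F
  proof (induction F)
    case empty
    show ?case by (simp add: dom_iff L2_zero coef_zero)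
  next
    case (insert g F)
    then obtain k where "g = h k" by auto
    with lincomb_in_dom[OF basis_in_dom[of k], of _ "c g" 1] insert show ?case by simp
  qed
  moreover from this have "coef v k = coef (\<lambda>x. \<Sum>g\<in>F. c g * g x) k" for k
    by (rule coef_cong_AE[OF v dom_L2 ae])
  ultimately show "v \<in> D" using v by (simp add: dom_iff)
qed

lemma dense_dom: "l2_dense M D"
  using span_subset_dom dom_L2 by (intro l2_dense_superset_span) auto

lemma operator: "l2_operator M D L"
  unfolding l2_operator_def
proof (intro conjI ballI allI impI)
  show "D \<subseteq> L2 M" "L ` D \<subseteq> L2 M" using dom_L2 op_L2 by auto
  show "(\<lambda>_. 0) \<in> D" by (simp add: dom_iff L2_zero coef_zero)
next
  fix f g assume f: "f \<in> D" and g: "g \<in> L2 M" and ae: "ae_eq M f g"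
  have c: "coef f k = coef g k" for k by (rule coef_cong_AE[OF dom_L2[OF f] g ae])
  then show gD: "g \<in> D" using f g by (simp add: dom_iff)
  show "ae_eq M (L f) (L g)"
    using f gD c by (intro coef_eqI op_L2) (auto simp: coef_op)
next
  fix f g a b assume f: "f \<in> D" and g: "g \<in> D"
  show lin: "(\<lambda>x. a * f x + b * g x) \<in> D" using f g by (rule lincomb_in_dom)
  show "ae_eq M (L (\<lambda>x. a * f x + b * g x)) (\<lambda>x. a * L f x + b * L g x)"
    using f g lin
    by (intro coef_eqI op_L2 L2_lincomb)
       (simp_all add: coef_op coef_lincomb op_L2 dom_L2 algebra_simps)
qed

lemma basis_eigenvector: "l2_eigenvector M D (\<lambda>v x. - L v x) (\<alpha> k) (h k)"
proof -
  have "\<not> ae_eq M (h k) (\<lambda>_. 0)"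
    using coef_cong_AE[OF h_L2 L2_zero, of k k] by (auto simp: coef_basis coef_zero)
  moreover have "ae_eq M (\<lambda>x. - L (h k) x) (\<lambda>x. \<alpha> k * h k x)"
    using basis_in_dom
    by (intro coef_eqI L2_uminus L2_scale op_L2 h_L2)
       (simp_all add: coef_uminus coef_scale coef_op coef_basis)
  ultimately show ?thesis by (simp add: l2_eigenvector_def basis_in_dom)
qed

lemma eigen_coef_zero:
  assumes "f \<in> D" "ae_eq M (\<lambda>x. - L f x) (\<lambda>x. \<mu> * f x)" "\<alpha> k \<noteq> \<mu>"
  shows "coef f k = 0"
proof -
  have "coef (\<lambda>x. - L f x) k = coef (\<lambda>x. \<mu> * f x) k"
    using assms by (intro coef_cong_AE L2_uminus L2_scale op_L2 dom_L2)
  then show ?thesis using assms by (simp add: coef_uminus coef_scale coef_op)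
qed

lemma eigenvalues: "l2_eigenvalues M D (\<lambda>v x. - L v x) = range \<alpha>"
proof
  show "range \<alpha> \<subseteq> l2_eigenvalues M D (\<lambda>v x. - L v x)"
    using basis_eigenvector by (auto simp: l2_eigenvalues_def)
  show "l2_eigenvalues M D (\<lambda>v x. - L v x) \<subseteq> range \<alpha>"
  proof
    fix \<mu> assume "\<mu> \<in> l2_eigenvalues M D (\<lambda>v x. - L v x)"
    then obtain f where f: "f \<in> D" "\<not> ae_eq M f (\<lambda>_. 0)" "ae_eq M (\<lambda>x. - L f x) (\<lambda>x. \<mu> * f x)"
      by (auto simp: l2_eigenvalues_def l2_eigenvector_def)
    then obtain k where "coef f k \<noteq> 0"
      using coef_eqI[OF dom_L2 L2_zero, of f] by (auto simp: coef_zero)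
    then have "\<alpha> k = \<mu>" using eigen_coef_zero[OF f(1,3)] by blast
    then show "\<mu> \<in> range \<alpha>" by blast
  qed
qed

lemma eigenspace_finite_dim:
  assumes "finite {k. \<alpha> k = \<mu>}"
  shows "l2_finite_dim M (l2_eigenspace M D (\<lambda>v x. - L v x) \<mu>)"
proof -
  let ?K = "{k. \<alpha> k = \<mu>}"
  have "f \<in> l2_span M (h ` ?K)" if "f \<in> l2_eigenspace M D (\<lambda>v x. - L v x) \<mu>" for f
  proof -
    have f: "f \<in> D" "ae_eq M (\<lambda>x. - L f x) (\<lambda>x. \<mu> * f x)"
      using that by (auto simp: l2_eigenspace_def)
    have sum: "(\<lambda>x. \<Sum>k\<in>?K. coef f k * h k x) \<in> l2_span M (h ` ?K)"
      by (intro l2_span_sum l2_span_base) (auto simp: h_L2)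
    have "coef (\<lambda>x. \<Sum>k\<in>?K. coef f k * h k x) j = (if \<alpha> j = \<mu> then coef f j else 0)" for j
      using assms unfolding coef_def
      by (subst l2_inner_lincomb_sum_left)
         (auto simp: h_L2 h_orthonormal if_distrib[of "\<lambda>t. _ * t"] cong: if_cong)
    then have "ae_eq M f (\<lambda>x. \<Sum>k\<in>?K. coef f k * h k x)"
      using eigen_coef_zero[OF f] f(1)
      by (intro coef_eqI dom_L2 L2_sum L2_scale h_L2) auto
    then show ?thesis by (rule l2_span_cong_AE[OF dom_L2[OF f(1)] _ sum])
  qed
  then show ?thesis
    using assms unfolding l2_finite_dim_def by (intro exI[of _ "h ` ?K"]) (auto simp: h_L2)
qed

lemma resolvent_bijective: "l2_bijective M D (\<lambda>v x. v x - L v x)"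
  unfolding l2_bijective_def
proof (intro conjI ballI impI)
  show "(\<lambda>v x. v x - L v x) ` D \<subseteq> L2 M"
    using dom_L2 op_L2 L2_diff by blast
  have c: "coef (\<lambda>x. v x - L v x) k = (1 + \<alpha> k) * coef v k" if "v \<in> D" for v k
    using that by (simp add: coef_diff dom_L2 op_L2 coef_op algebra_simps)
  have pos: "1 + \<alpha> k > 0" for k using \<alpha>_nonneg[of k] by simp
  {
    fix f g assume f: "f \<in> D" and g: "g \<in> D" and ae: "ae_eq M (\<lambda>x. f x - L f x) (\<lambda>x. g x - L g x)"
    have "(1 + \<alpha> k) * coef f k = (1 + \<alpha> k) * coef g k" for k
      using coef_cong_AE[OF L2_diff L2_diff ae, of k] f g by (simp add: c dom_L2 op_L2)
    then show "ae_eq M f g"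
      using f g pos by (intro coef_eqI dom_L2) (auto simp: less_le)
  next
    fix g assume g: "g \<in> L2 M"
    define a where "a k = coef g k / (1 + \<alpha> k)" for k
    \<comment> \<open>Used with \<open>t = 1\<close> to get \<open>f\<close> in \<open>L2 M\<close>, and with \<open>t = \<alpha> k\<close> to get \<open>f\<close> in the domain.\<close>
    have le: "(a k)\<^sup>2 * t\<^sup>2 \<le> (coef g k)\<^sup>2" if "0 \<le> t" "t \<le> 1 + \<alpha> k" for k t
    proof -
      have "(a k)\<^sup>2 * t\<^sup>2 = (coef g k)\<^sup>2 * (t / (1 + \<alpha> k))\<^sup>2"
        by (simp add: a_def power_divide)
      also have "\<dots> \<le> (coef g k)\<^sup>2 * 1"
        using that pos[of k] by (intro mult_left_mono power_le_one) auto
      finally show ?thesis by simp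
    qed
    have "summable (\<lambda>k. (a k)\<^sup>2)"
      by (rule summable_comparison_test'[OF Bessel[OF g]]) (use le[of 1] \<alpha>_nonneg in auto)
    then obtain f where f: "f \<in> L2 M" "\<And>k. coef f k = a k" using ex_coef by blast
    have "summable (\<lambda>k. (a k)\<^sup>2 * (\<alpha> k)\<^sup>2)"
      by (rule summable_comparison_test'[OF Bessel[OF g]]) (use le \<alpha>_nonneg in auto)
    then have fD: "f \<in> D" using f by (simp add: dom_iff)
    have "ae_eq M (\<lambda>x. f x - L f x) g"
    proof (rule coef_eqI)
      show "(\<lambda>x. f x - L f x) \<in> L2 M" using fD dom_L2 op_L2 L2_diff by blast
      show "coef (\<lambda>x. f x - L f x) k = coef g k" for k
        using pos[of k] by (simp add: c[OF fD] f(2) a_def)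
    qed (rule g)
    with fD show "\<exists>f\<in>D. ae_eq M (\<lambda>x. f x - L f x) g" by blast
  }
qed

text \<open>
  If \<open>(g, w)\<close> is in the graph of the adjoint, testing against the basis vectors gives
  \<open>coef w k = - \<alpha> k * coef g k\<close>.  Since \<open>w\<close> is in \<open>L\<^sup>2\<close>, these numbers are square summable, and this is
  exactly the condition for \<open>g\<close> to be in the domain.
\<close>

lemma self_adjoint: "l2_self_adjoint M D L"
proof -
  have "(g, w) \<in> l2_graph M D L" if "(g, w) \<in> l2_adjoint_graph M D L" for g w
  proof -
    have g: "g \<in> L2 M" and w: "w \<in> L2 M"
      and adj: "\<And>f. f \<in> D \<Longrightarrow> l2_inner M (L f) g = l2_inner M f w"
      using that by (auto simp: l2_adjoint_graph_def)
    have cw: "coef w k = - \<alpha> k * coef g k" for k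
    proof -
      have "ae_eq M (L (h k)) (\<lambda>x. - \<alpha> k * h k x)"
        using basis_eigenvector[of k] by (auto simp: l2_eigenvector_def elim!: eventually_mono)
      then have "l2_inner M (L (h k)) g = l2_inner M (\<lambda>x. - \<alpha> k * h k x) g"
        using basis_in_dom g by (intro l2_inner_cong_AE op_L2 L2_scale h_L2) auto
      then show ?thesis
        using adj[OF basis_in_dom[of k]]
        by (simp add: l2_inner_scale_left l2_inner_uminus_left coef_def l2_inner_commute[of M g "h k"] l2_inner_commute[of M w "h k"])
    qed
    have "(\<lambda>k. (coef g k)\<^sup>2 * (\<alpha> k)\<^sup>2) = (\<lambda>k. (coef w k)\<^sup>2)"
      by (simp add: cw power_mult_distrib mult.commute)
    with Bessel[OF w] g have gD: "g \<in> D" by (simp add: dom_iff)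
    then have "ae_eq M (L g) w" using w by (intro coef_eqI op_L2) (simp_all add: coef_op cw)
    with gD w show ?thesis by (simp add: l2_graph_def)
  qed
  moreover have "(g, w) \<in> l2_adjoint_graph M D L" if "(g, w) \<in> l2_graph M D L" for g w
  proof -
    have g: "g \<in> D" and w: "w \<in> L2 M" and ae: "ae_eq M (L g) w"
      using that by (auto simp: l2_graph_def)
    have "coef w k = - \<alpha> k * coef g k" for k
      using coef_cong_AE[OF op_L2[OF g] w ae] g by (simp add: coef_op)
    then have "l2_inner M (L f) g = l2_inner M f w" if "f \<in> D" for f
      using Parseval[OF op_L2[OF that] dom_L2[OF g]] Parseval[OF dom_L2[OF that] w] that
      by (simp add: coef_op mult.commute mult.left_commute sums_unique2)
    with g w show ?thesis by (auto simp: l2_adjoint_graph_def dom_L2)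
  qed
  ultimately show ?thesis
    unfolding l2_self_adjoint_def using operator dense_dom by auto
qed

lemma nonneg:
  assumes f: "f \<in> D"
  shows "0 \<le> l2_inner M (\<lambda>x. - L f x) f"
proof -
  have "(\<lambda>k. \<alpha> k * (coef f k)\<^sup>2) sums l2_inner M (\<lambda>x. - L f x) f"
    using Parseval[OF L2_uminus[OF op_L2[OF f]] dom_L2[OF f]] f
    by (simp add: coef_uminus coef_op power2_eq_square mult.assoc)
  then show ?thesis
    by (rule sums_le[OF _ sums_zero, rotated]) (simp add: \<alpha>_nonneg)
qed

lemma dissipative:
  assumes g: "g \<in> D" and "\<mu> > 0"
  shows "l2_norm M (\<lambda>x. \<mu> * g x) \<le> l2_norm M (\<lambda>x. \<mu> * g x - L g x)"
proof -
  have L: "(\<lambda>x. \<mu> * g x) \<in> L2 M" "(\<lambda>x. \<mu> * g x - L g x) \<in> L2 M"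
    using g by (simp_all add: dom_L2 op_L2 L2_scale L2_diff)
  have "(\<lambda>k. \<mu>\<^sup>2 * (coef g k)\<^sup>2) sums l2_inner M (\<lambda>x. \<mu> * g x) (\<lambda>x. \<mu> * g x)"
    using Parseval[OF L(1,1)] by (simp add: coef_scale power2_eq_square mult_ac)
  moreover have "coef (\<lambda>x. \<mu> * g x - L g x) k = (\<mu> + \<alpha> k) * coef g k" for k
    using g by (simp add: coef_diff coef_scale L op_L2 coef_op algebra_simps)
  then have "(\<lambda>k. (\<mu> + \<alpha> k)\<^sup>2 * (coef g k)\<^sup>2) sums
      l2_inner M (\<lambda>x. \<mu> * g x - L g x) (\<lambda>x. \<mu> * g x - L g x)"
    using Parseval[OF L(2,2)] by (simp add: power2_eq_square mult_ac)
  ultimately have "l2_inner M (\<lambda>x. \<mu> * g x) (\<lambda>x. \<mu> * g x) \<le>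
      l2_inner M (\<lambda>x. \<mu> * g x - L g x) (\<lambda>x. \<mu> * g x - L g x)"
    using \<open>\<mu> > 0\<close> \<alpha>_nonneg
    by (elim sums_le[of "\<lambda>k. \<mu>\<^sup>2 * (coef g k)\<^sup>2" "\<lambda>k. (\<mu> + \<alpha> k)\<^sup>2 * (coef g k)\<^sup>2", rotated])
       (assumption, rule square_le_square, simp_all)
  then show ?thesis by (simp add: l2_norm_def)
qed

end

section \<open>Enumerating the eigenvalues in increasing order\<close>

text \<open>
  Ordering the indices by \<open>\<alpha>\<close>, with ties broken by the index itself, gives a linear order in which each
  element has finitely many predecessors.  Their number is the rank of the element, and the rank is a
  bijection onto the natural numbers whose inverse is the enumeration.
\<close>

lemma increasing_enumeration:
  fixes \<alpha> :: "nat \<Rightarrow> real"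
  assumes fin: "\<And>C. finite {k. \<alpha> k \<le> C}"
  shows "\<exists>\<sigma> :: nat \<Rightarrow> nat. bij \<sigma> \<and> mono (\<lambda>n. \<alpha> (\<sigma> n))"
proof -
  define pre where "pre k = {j. \<alpha> j < \<alpha> k \<or> \<alpha> j = \<alpha> k \<and> j < k}" for k
  define r where "r k = card (pre k)" for k
  have fp: "finite (pre k)" for k
    by (rule finite_subset[OF _ fin[of "\<alpha> k"]]) (auto simp: pre_def)
  have less: "r j < r k" if "j \<in> pre k" for j k
  proof -
    have "pre j \<subset> pre k" using that by (auto simp: pre_def)
    then show ?thesis unfolding r_def by (intro psubset_card_mono fp)
  qed
  have tot: "j \<in> pre k \<or> k \<in> pre j" if "j \<noteq> k" for j k
    using that by (auto simp: pre_def)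
  have inj: "inj r"
    by (rule injI) (metis less tot less_irrefl)
  have less_iff: "r j < r k \<longleftrightarrow> j \<in> pre k" for j k
  proof (rule iffI)
    assume lt: "r j < r k"
    then have "j \<noteq> k" by (rule contrapos_pn) simp
    moreover have "k \<notin> pre j" using lt less[of k j] less_asym[of "r j" "r k"] by blast
    ultimately show "j \<in> pre k" using tot[of j k] by blast
  qed (rule less)
  \<comment> \<open>The range of \<open>r\<close> is an initial segment: both \<open>pre k\<close> and \<open>{..<r k}\<close> have \<open>r k\<close> elements.\<close>
  have down: "{..<r k} \<subseteq> range r" for k
  proof -
    have "r ` pre k = {..<r k}"
    proof (rule card_subset_eq)
      show "r ` pre k \<subseteq> {..<r k}" by (rule image_subsetI) (simp only: lessThan_iff less)
      show "card (r ` pre k) = card {..<r k}"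
        using inj_on_subset[OF inj, of "pre k"] by (simp add: card_image r_def[of k])
    qed simp
    then show ?thesis by blast
  qed
  have "surj r"
  proof -
    have "infinite (range r)" using inj by (rule range_inj_infinite)
    then have "\<exists>m>n. m \<in> range r" for n by (simp add: infinite_nat_iff_unbounded)
    then have "\<exists>k. n < r k" for n by blast
    then have "n \<in> range r" for n using down by blast
    then show ?thesis by blast
  qed
  with inj have bij: "bij r" by (simp add: bij_def)
  have "mono (\<lambda>n. \<alpha> (inv r n))"
  proof (rule monoI)
    fix m n :: nat assume "m \<le> n"
    show "\<alpha> (inv r m) \<le> \<alpha> (inv r n)"
    proof (cases "m = n")
      case False
      with \<open>m \<le> n\<close> have "r (inv r m) < r (inv r n)"
        using bij by (simp add: bij_is_surj surj_f_inv_f)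
      then show ?thesis unfolding less_iff by (auto simp: pre_def)
    qed simp
  qed
  with bij_imp_bij_inv[OF bij] show ?thesis by blast
qed

lemma filterlim_at_top_of_finite_sublevels:
  fixes \<beta> :: "nat \<Rightarrow> real"
  assumes "\<And>C. finite {k. \<beta> k \<le> C}"
  shows "filterlim \<beta> at_top sequentially"
  unfolding filterlim_at_top_dense
proof
  fix C
  show "\<forall>\<^sub>F n in sequentially. C < \<beta> n"
    using assms[of C] unfolding cofinite_eq_sequentially[symmetric] eventually_cofinite
    by (simp add: not_less)
qed

lemma eigenvalue_enumeration:
  fixes \<alpha> :: "nat \<Rightarrow> real"
  assumes fin: "\<And>C. finite {k. \<alpha> k \<le> C}" and nonneg: "\<And>k. 0 \<le> \<alpha> k" and zero: "\<alpha> k0 = 0"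
  shows "\<exists>\<sigma> :: nat \<Rightarrow> nat. bij \<sigma> \<and> \<alpha> (\<sigma> 0) = 0 \<and> mono (\<lambda>n. \<alpha> (\<sigma> n)) \<and>
           filterlim (\<lambda>n. \<alpha> (\<sigma> n)) at_top sequentially"
proof -
  obtain \<sigma> :: "nat \<Rightarrow> nat" where \<sigma>: "bij \<sigma>" "mono (\<lambda>n. \<alpha> (\<sigma> n))" using increasing_enumeration[OF fin] by blast
  obtain n where "\<sigma> n = k0" using \<sigma>(1) by (metis bij_pointE)
  then have "\<alpha> (\<sigma> 0) \<le> 0" using monoD[OF \<sigma>(2), of 0 n] zero by simp
  then have "\<alpha> (\<sigma> 0) = 0" using nonneg[of "\<sigma> 0"] by simp
  moreover have "filterlim (\<lambda>n. \<alpha> (\<sigma> n)) at_top sequentially"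
  proof (rule filterlim_at_top_of_finite_sublevels)
    fix C
    have "{k. \<alpha> (\<sigma> k) \<le> C} = \<sigma> -` {k. \<alpha> k \<le> C}" by auto
    then show "finite {k. \<alpha> (\<sigma> k) \<le> C}"
      using finite_vimageI[OF fin[of C] bij_is_inj[OF \<sigma>(1)]] by simp
  qed
  ultimately show ?thesis using \<sigma> by blast
qed

section \<open>Fluxes and Green's formula in one dimension\<close>

lemma space_torus: "space torus = {0..<1}"
  by (simp add: torus_def space_restrict_space)

lemma id_torus: "(\<lambda>x. x) \<in> borel_measurable torus"
  unfolding torus_def by (intro measurable_restrict_space1) simp

lemma prob_space_torus: "prob_space torus"
  by (rule prob_spaceI) (simp add: torus_def space_restrict_space emeasure_restrict_space)

lemma integral_torus: "(LINT x|torus. f x) = (LINT x:{0..<1}|lborel. f x)" for f :: "real \<Rightarrow> real"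
  unfolding torus_def set_lebesgue_integral_def by (rule integral_restrict_space) simp

text \<open>
  The measure \<open>W(dy)\<close> is restricted to one period, where it is finite with mass \<open>W 1\<close>.
\<close>

definition stieltjes :: "(real \<Rightarrow> real) \<Rightarrow> real measure" where
  "stieltjes W = restrict_space (interval_measure W) {0<..1}"

text \<open>
  The function with value \<open>a\<close> at \<open>0\<close> and \<open>dW\<close>-derivative \<open>p\<close>, that is, \<open>a\<close> plus the integral of \<open>p dW\<close>
  over \<open>(0,x]\<close>, for \<open>x\<close> in \<open>[0,1]\<close>.  With a domain of integration that does not depend on \<open>x\<close>, Fubini's
  theorem applies directly.
\<close>

definition potential :: "(real \<Rightarrow> real) \<Rightarrow> real \<Rightarrow> (real \<Rightarrow> real) \<Rightarrow> real \<Rightarrow> real" where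
  "potential W a p x = a + (LINT y|stieltjes W. (if y \<le> x then p y else 0))"

lemma space_stieltjes: "space (stieltjes W) = {0<..1}"
  by (simp add: stieltjes_def space_restrict_space)

lemma id_stieltjes: "(\<lambda>x. x) \<in> borel_measurable (stieltjes W)"
  unfolding stieltjes_def by (intro measurable_restrict_space1) simp

lemma stieltjes_measurable: "p \<in> borel_measurable borel \<Longrightarrow> p \<in> borel_measurable (stieltjes W)"
  using measurable_compose[OF id_stieltjes] .

lemma cut_measurable:
  fixes p :: "real \<Rightarrow> real"
  assumes [measurable]: "p \<in> borel_measurable borel"
  shows "(\<lambda>y. if y \<le> x then p y else 0) \<in> borel_measurable borel"
  by measurable

context
  fixes W :: "real \<Rightarrow> real"
  assumes W: "admissible W"
begin

lemma emeasure_interval: "a \<le> b \<Longrightarrow> emeasure (interval_measure W) {a<..b} = W b - W a"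
  using W by (intro emeasure_interval_measure_Ioc) (auto simp: admissible_def strict_mono_less_eq)

lemma emeasure_stieltjes: "emeasure (stieltjes W) (space (stieltjes W)) = W 1"
  using W by (simp add: stieltjes_def space_restrict_space emeasure_restrict_space
      emeasure_interval admissible_def)

lemma finite_stieltjes: "finite_measure (stieltjes W)"
  by (rule finite_measureI) (simp add: emeasure_stieltjes)

lemma W1_nonneg: "0 \<le> W 1"
  using W by (metis admissible_def strict_mono_less_eq zero_le_one)

lemma measure_stieltjes: "measure (stieltjes W) (space (stieltjes W)) = W 1"
  by (simp add: measure_def emeasure_stieltjes W1_nonneg)

lemma integral_stieltjes_upto:
  fixes q :: "real \<Rightarrow> real"
  assumes "x \<le> 1"
  shows "(LINT y:{0<..x}|interval_measure W. q y) = (LINT y|stieltjes W. (if y \<le> x then q y else 0))"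
proof -
  have "(LINT y|stieltjes W. (if y \<le> x then q y else 0)) =
      (LINT y|interval_measure W. indicator {0<..1} y *\<^sub>R (if y \<le> x then q y else 0))"
    unfolding stieltjes_def by (rule integral_restrict_space) simp
  also have "\<dots> = (LINT y:{0<..x}|interval_measure W. q y)"
    unfolding set_lebesgue_integral_def using assms
    by (intro Bochner_Integration.integral_cong) (auto split: split_indicator)
  finally show ?thesis ..
qed

lemma integrable_stieltjes:
  fixes p :: "real \<Rightarrow> real"
  assumes "p \<in> borel_measurable borel" "\<And>y. \<bar>p y\<bar> \<le> B"
  shows "integrable (stieltjes W) p"
  using assms finite_stieltjes
  by (intro finite_measure.integrable_const_bound[where B = B] stieltjes_measurable) auto

lemma L2_stieltjes:
  fixes p :: "real \<Rightarrow> real"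
  assumes "p \<in> borel_measurable borel" "\<And>y. \<bar>p y\<bar> \<le> B"
  shows "p \<in> L2 (stieltjes W)"
  by (rule L2_bounded[OF finite_stieltjes stieltjes_measurable]) (use assms in auto)

lemma potential_measurable:
  fixes p :: "real \<Rightarrow> real"
  assumes p: "p \<in> borel_measurable borel"
  shows "potential W a p \<in> borel_measurable torus"
proof -
  interpret finite_measure "stieltjes W" by (rule finite_stieltjes)
  have [measurable]: "(\<lambda>z. fst z) \<in> borel_measurable (torus \<Otimes>\<^sub>M stieltjes W)"
      "(\<lambda>z. snd z) \<in> borel_measurable (torus \<Otimes>\<^sub>M stieltjes W)"
    using measurable_compose[OF measurable_fst id_torus] measurable_compose[OF measurable_snd id_stieltjes]
    by auto
  have [measurable]: "(\<lambda>z. p (snd z)) \<in> borel_measurable (torus \<Otimes>\<^sub>M stieltjes W)"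
    by (rule measurable_compose[OF _ p]) measurable
  have "(\<lambda>z. if snd z \<le> fst z then p (snd z) else 0) \<in> borel_measurable (torus \<Otimes>\<^sub>M stieltjes W)"
    by measurable
  then have "(\<lambda>x. LINT y|stieltjes W. (if y \<le> x then p y else 0)) \<in> borel_measurable torus"
    by (intro borel_measurable_lebesgue_integral) (simp add: split_def)
  then show ?thesis unfolding potential_def by (intro borel_measurable_add) auto
qed

lemma potential_bounded:
  fixes p :: "real \<Rightarrow> real"
  assumes p: "p \<in> borel_measurable borel" "\<And>y. \<bar>p y\<bar> \<le> B"
  shows "\<bar>potential W a p x\<bar> \<le> \<bar>a\<bar> + B * W 1"
proof -
  interpret finite_measure "stieltjes W" by (rule finite_stieltjes)
  have B: "0 \<le> B" using p(2)[of 0] by linarith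
  have "\<bar>LINT y|stieltjes W. (if y \<le> x then p y else 0)\<bar> \<le> (LINT y|stieltjes W. B)"
    by (rule integral_abs_bound_integral)
       (use p B in \<open>auto intro!: integrable_stieltjes[of _ B] cut_measurable\<close>)
  also have "\<dots> = B * W 1" by (simp add: measure_stieltjes)
  finally show ?thesis unfolding potential_def by linarith
qed

lemma potential_L2:
  fixes p :: "real \<Rightarrow> real"
  assumes p: "p \<in> borel_measurable borel" "\<And>y. \<bar>p y\<bar> \<le> B"
  shows "potential W a p \<in> L2 torus"
  by (rule L2_bounded[OF prob_space.finite_measure[OF prob_space_torus] potential_measurable[OF p(1)]
        potential_bounded[OF p]])

lemma potential_sum:
  assumes "\<And>i. i \<in> I \<Longrightarrow> p i \<in> borel_measurable borel" "\<And>i y. i \<in> I \<Longrightarrow> \<bar>p i y\<bar> \<le> B i"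
  shows "(\<Sum>i\<in>I. c i * potential W (a i) (p i) x) =
    potential W (\<Sum>i\<in>I. c i * a i) (\<lambda>y. \<Sum>i\<in>I. c i * p i y) x"
proof -
  have int: "integrable (stieltjes W) (\<lambda>y. if y \<le> x then p i y else 0)" if "i \<in> I" for i
  proof (rule integrable_stieltjes[of _ "B i"])
    show "\<bar>if y \<le> x then p i y else 0\<bar> \<le> B i" for y
      using assms(2)[OF that, of y] by (auto intro: order_trans[OF abs_ge_zero])
  qed (intro cut_measurable assms(1) that)
  have "(LINT y|stieltjes W. (if y \<le> x then (\<Sum>i\<in>I. c i * p i y) else 0)) =
      (LINT y|stieltjes W. (\<Sum>i\<in>I. c i * (if y \<le> x then p i y else 0)))"
    by (rule Bochner_Integration.integral_cong) auto
  also have "\<dots> = (\<Sum>i\<in>I. c i * (LINT y|stieltjes W. (if y \<le> x then p i y else 0)))"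
    using int by (subst Bochner_Integration.integral_sum) auto
  finally show ?thesis
    by (simp add: potential_def distrib_left sum.distrib)
qed

text \<open>
  The difference is the integral of \<open>q\<close> over the interval between \<open>x\<close> and \<open>t\<close>, written as the inner
  product of \<open>q\<close> with a function \<open>s\<close> with values in \<open>{-1, 0, 1}\<close>; then Cauchy--Schwarz.
\<close>

lemma potential_oscillation:
  assumes q: "q \<in> borel_measurable borel" "\<And>y. \<bar>q y\<bar> \<le> B"
  shows "(potential W a q x - potential W a q t)\<^sup>2 \<le> W 1 * (LINT y|stieltjes W. (q y)\<^sup>2)"
proof -
  interpret finite_measure "stieltjes W" by (rule finite_stieltjes)
  have B: "0 \<le> B" using q(2)[of 0] by linarith
  define s :: "real \<Rightarrow> real" where "s y = (if y \<le> x then 1 else 0) - (if y \<le> t then 1 else 0)" for y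
  have s1: "s \<in> borel_measurable borel" unfolding s_def by measurable
  have s2: "\<bar>s y\<bar> \<le> 1" for y by (auto simp: s_def)
  note s = s1 s2
  have int: "integrable (stieltjes W) (\<lambda>y. if y \<le> u then q y else 0)" for u
    by (rule integrable_stieltjes[of _ B]) (use q B in \<open>auto intro!: cut_measurable\<close>)
  have "potential W a q x - potential W a q t =
      (LINT y|stieltjes W. (if y \<le> x then q y else 0) - (if y \<le> t then q y else 0))"
    unfolding potential_def using int by (subst Bochner_Integration.integral_diff) auto
  also have "\<dots> = l2_inner (stieltjes W) s q"
    unfolding l2_inner_def s_def by (rule Bochner_Integration.integral_cong) auto
  finally have "(potential W a q x - potential W a q t)\<^sup>2 \<le>
      l2_inner (stieltjes W) s s * l2_inner (stieltjes W) q q"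
    using l2_Cauchy_Schwarz[OF L2_stieltjes[OF s] L2_stieltjes[OF q]] by simp
  also have "l2_inner (stieltjes W) s s \<le> (LINT y|stieltjes W. 1)"
    unfolding l2_inner_def
  proof (rule integral_mono)
    show "integrable (stieltjes W) (\<lambda>y. s y * s y)"
      using L2_integrable_mult[OF L2_stieltjes[OF s] L2_stieltjes[OF s]] .
    show "s y * s y \<le> 1" for y by (auto simp: s_def)
  qed simp
  then have "l2_inner (stieltjes W) s s * l2_inner (stieltjes W) q q
      \<le> W 1 * l2_inner (stieltjes W) q q"
    using l2_inner_self_nonneg[of "stieltjes W" q] measure_stieltjes
    by (intro mult_right_mono) auto
  finally show ?thesis by (simp add: l2_inner_def power2_eq_square)
qed

text \<open>
  A one-dimensional Sobolev inequality: the value at \<open>x\<close> differs from the values at the other points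
  \<open>t\<close> by an amount controlled by the energy \<open>\<integral> q\<^sup>2 dW\<close>, and averaging over \<open>t\<close> brings in the norm.
\<close>

lemma potential_pointwise:
  assumes q: "q \<in> borel_measurable borel" "\<And>y. \<bar>q y\<bar> \<le> B"
  shows "(potential W a q x)\<^sup>2 \<le>
    2 * l2_inner torus (potential W a q) (potential W a q) + 2 * W 1 * (LINT y|stieltjes W. (q y)\<^sup>2)"
proof -
  interpret prob_space torus by (rule prob_space_torus)
  let ?u = "potential W a q" and ?E = "LINT y|stieltjes W. (q y)\<^sup>2"
  have "(LINT t|torus. (?u x)\<^sup>2) \<le> (LINT t|torus. 2 * (?u t * ?u t) + 2 * W 1 * ?E)"
  proof (rule integral_mono)
    show "integrable torus (\<lambda>t. 2 * (?u t * ?u t) + 2 * W 1 * ?E)"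
      using L2_integrable_mult[OF potential_L2[OF q] potential_L2[OF q], of a a] by simp
    fix t
    have "(?u x)\<^sup>2 \<le> 2 * (?u t * ?u t) + 2 * (?u x - ?u t)\<^sup>2"
      using zero_le_power2[of "?u x - 2 * ?u t"] by (simp add: power2_eq_square algebra_simps)
    then show "(?u x)\<^sup>2 \<le> 2 * (?u t * ?u t) + 2 * W 1 * ?E"
      using potential_oscillation[OF q, of a x t] by linarith
  qed simp
  also have "\<dots> = 2 * l2_inner torus ?u ?u + 2 * W 1 * ?E"
    using L2_integrable_mult[OF potential_L2[OF q] potential_L2[OF q], of a a]
    by (simp add: l2_inner_def prob_space)
  finally show ?thesis by (simp add: prob_space)
qed

text \<open>
  Every function in the domain is almost everywhere the potential of its flux \<open>p = b + \<Phi>\<close>, where \<open>\<Phi> y\<close>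
  is the integral of \<open>\<phi>\<close> over \<open>[0, y)\<close>; this is a bounded function, and the condition \<open>\<integral> p dW = 0\<close> says
  that the potential is periodic.  The last conjunct is Green's formula \<open>\<langle>\<phi>, g\<rangle> = - \<integral> p q dW\<close> for the
  potential \<open>g\<close> of a bounded \<open>q\<close> with \<open>\<integral> q dW = 0\<close>.  After exchanging the order of
  integration, the factor of \<open>q y\<close> is \<open>\<integral> \<phi>\<close> over \<open>[y, 1)\<close>, which is \<open>- \<Phi> y\<close> because \<open>\<phi>\<close> has mean zero;
  the constant \<open>b\<close> may then be added to \<open>\<Phi>\<close> because \<open>\<integral> q dW = 0\<close>.
\<close>

lemma gen_deriv_flux:
  assumes f: "gen_deriv W f \<phi>"
  shows "\<exists>a p B. p \<in> borel_measurable borel \<and> (\<forall>y. \<bar>p y\<bar> \<le> B) \<and>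
    (LINT y|stieltjes W. p y) = 0 \<and> ae_eq torus f (potential W a p) \<and>
    (\<forall>q a' B'. q \<in> borel_measurable borel \<and> (\<forall>y. \<bar>q y\<bar> \<le> B') \<and> (LINT y|stieltjes W. q y) = 0 \<longrightarrow>
      l2_inner torus \<phi> (potential W a' q) = - (LINT y|stieltjes W. p y * q y))"
proof -
  interpret T: prob_space torus by (rule prob_space_torus)
  interpret S: finite_measure "stieltjes W" by (rule finite_stieltjes)
  interpret P: pair_sigma_finite torus "stieltjes W" ..
  from f obtain a b where \<phi>: "\<phi> \<in> L2 torus" and int0: "(LINT z:{0..<1}|lborel. \<phi> z) = 0"
    and flux0: "(LINT y:{0<..1}|interval_measure W. b + (LINT z:{0..<y}|lborel. \<phi> z)) = 0"
    and ae: "ae_eq torus f (\<lambda>x. a + b * W x +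
          (LINT y:{0<..x}|interval_measure W. LINT z:{0..<y}|lborel. \<phi> z))"
    unfolding gen_deriv_def by blast
  have \<phi>_meas: "\<phi> \<in> borel_measurable torus" using \<phi> by (rule L2_measurable)
  have one: "(\<lambda>_. 1) \<in> L2 torus" by (simp add: L2_def)
  have \<phi>_int: "integrable torus \<phi>" using L2_integrable_mult[OF \<phi> one] by simp
  have \<phi>_int0: "(LINT z|torus. \<phi> z) = 0" using int0 by (simp add: integral_torus)
  define \<Phi> where "\<Phi> y = (LINT z|torus. (if z < y then \<phi> z else 0))" for y :: real
  have \<Phi>_eq: "(LINT z:{0..<y}|lborel. \<phi> z) = \<Phi> y" if "y \<le> 1" for y
    unfolding \<Phi>_def integral_torus set_lebesgue_integral_def
    using that by (intro Bochner_Integration.integral_cong) (auto split: split_indicator)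
  have cut_int: "integrable torus (\<lambda>z. if z < y then \<phi> z else 0)" for y
  proof (rule Bochner_Integration.integrable_bound[OF \<phi>_int])
    have [measurable]: "(\<lambda>z. z) \<in> borel_measurable torus" by (rule id_torus)
    note \<phi>_meas[measurable]
    show "(\<lambda>z. if z < y then \<phi> z else 0) \<in> borel_measurable torus" by measurable
  qed auto
  define K where "K = (LINT z|torus. \<bar>\<phi> z\<bar>)"
  have \<Phi>_bound: "\<bar>\<Phi> y\<bar> \<le> K" for y
    unfolding \<Phi>_def K_def
    by (rule integral_abs_bound_integral) (use cut_int \<phi>_int in auto)
  have \<Phi>_meas: "\<Phi> \<in> borel_measurable borel"
  proof -
    have [measurable]: "(\<lambda>z. snd z) \<in> borel_measurable (borel \<Otimes>\<^sub>M torus)"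
      by (rule measurable_compose[OF measurable_snd id_torus])
    have [measurable]: "(\<lambda>z. fst z :: real) \<in> borel_measurable (borel \<Otimes>\<^sub>M torus)"
      by (rule measurable_fst)
    have [measurable]: "(\<lambda>z. \<phi> (snd z)) \<in> borel_measurable (borel \<Otimes>\<^sub>M torus)"
      by (rule measurable_compose[OF measurable_snd \<phi>_meas])
    have "(\<lambda>z. if snd z < fst z then \<phi> (snd z) else 0) \<in> borel_measurable (borel \<Otimes>\<^sub>M torus)"
      by measurable
    then show ?thesis
      unfolding \<Phi>_def by (intro T.borel_measurable_lebesgue_integral) (simp add: split_def)
  qed
  define p where "p y = b + \<Phi> y" for y
  have p: "p \<in> borel_measurable borel" "\<bar>p y\<bar> \<le> \<bar>b\<bar> + K" for y
    using \<Phi>_meas \<Phi>_bound[of y] unfolding p_def by auto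
  have \<Phi>_int: "integrable (stieltjes W) (\<lambda>y. if y \<le> x then \<Phi> y else 0)" for x
    by (rule integrable_stieltjes[of _ K])
       (use \<Phi>_meas \<Phi>_bound order_trans[OF abs_ge_zero \<Phi>_bound] in \<open>auto intro!: cut_measurable\<close>)
  have "(LINT y|stieltjes W. p y) = (LINT y|stieltjes W. (if y \<le> 1 then p y else 0))"
    by (rule Bochner_Integration.integral_cong) (auto simp: space_stieltjes)
  also have "\<dots> = (LINT y:{0<..1}|interval_measure W. p y)"
    by (simp add: integral_stieltjes_upto)
  also have "\<dots> = (LINT y:{0<..1}|interval_measure W. b + (LINT z:{0..<y}|lborel. \<phi> z))"
    by (rule set_lebesgue_integral_cong) (auto simp: p_def \<Phi>_eq)
  finally have p0: "(LINT y|stieltjes W. p y) = 0" using flux0 by simp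
  have "potential W a p x = a + b * W x +
      (LINT y:{0<..x}|interval_measure W. LINT z:{0..<y}|lborel. \<phi> z)" if x: "x \<in> {0..<1}" for x
  proof -
    have "(LINT y:{0<..x}|interval_measure W. LINT z:{0..<y}|lborel. \<phi> z) =
        (LINT y:{0<..x}|interval_measure W. \<Phi> y)"
      using x by (intro set_lebesgue_integral_cong) (auto simp: \<Phi>_eq)
    moreover have "(LINT y:{0<..x}|interval_measure W. b) = b * W x"
      using x emeasure_interval[of 0 x] W strict_mono_less_eq[of W 0 x]
      by (simp add: set_integral_const measure_def admissible_def)
    moreover have "potential W a p x = a + (LINT y:{0<..x}|interval_measure W. b) +
        (LINT y:{0<..x}|interval_measure W. \<Phi> y)"
    proof -
      have "(LINT y|stieltjes W. (if y \<le> x then p y else 0)) =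
          (LINT y|stieltjes W. (if y \<le> x then b else 0) + (if y \<le> x then \<Phi> y else 0))"
        by (rule Bochner_Integration.integral_cong) (auto simp: p_def)
      also have "\<dots> = (LINT y|stieltjes W. (if y \<le> x then b else 0)) +
          (LINT y|stieltjes W. (if y \<le> x then \<Phi> y else 0))"
        by (intro Bochner_Integration.integral_add \<Phi>_int integrable_stieltjes[of _ "\<bar>b\<bar>"] cut_measurable)
           auto
      finally show ?thesis
        using x by (simp add: potential_def integral_stieltjes_upto)
    qed
    ultimately show ?thesis by simp
  qed
  then have "AE x in torus. f x = a + b * W x +
      (LINT y:{0<..x}|interval_measure W. LINT z:{0..<y}|lborel. \<phi> z) \<longrightarrow> f x = potential W a p x"
    by (intro AE_I2) (simp add: space_torus)
  with ae have ae': "ae_eq torus f (potential W a p)"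
    by (rule AE_mp)
  have green: "l2_inner torus \<phi> (potential W a' q) = - (LINT y|stieltjes W. p y * q y)"
    if q: "q \<in> borel_measurable borel" "\<And>y. \<bar>q y\<bar> \<le> B'" and q0: "(LINT y|stieltjes W. q y) = 0" for q a' B'
  proof -
    have B': "0 \<le> B'" using q(2)[of 0] by linarith
    define F where "F = (\<lambda>(x, y). \<phi> x * (if y \<le> x then q y else 0))"
    have q_int: "integrable (stieltjes W) (\<lambda>y. if y \<le> x then q y else 0)" for x
      by (rule integrable_stieltjes[of _ B']) (use q B' in \<open>auto intro!: cut_measurable\<close>)
    have F: "integrable (torus \<Otimes>\<^sub>M stieltjes W) F"
    proof (rule Bochner_Integration.integrable_bound)
      have [measurable]: "(\<lambda>z. fst z) \<in> borel_measurable (torus \<Otimes>\<^sub>M stieltjes W)"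
        "(\<lambda>z. snd z) \<in> borel_measurable (torus \<Otimes>\<^sub>M stieltjes W)"
        "(\<lambda>z. \<phi> (fst z)) \<in> borel_measurable (torus \<Otimes>\<^sub>M stieltjes W)"
        "(\<lambda>z. q (snd z)) \<in> borel_measurable (torus \<Otimes>\<^sub>M stieltjes W)"
        using measurable_compose[OF measurable_fst id_torus]
          measurable_compose[OF measurable_snd id_stieltjes]
          measurable_compose[OF measurable_fst \<phi>_meas]
          measurable_compose[OF measurable_snd stieltjes_measurable[OF q(1)]] by auto
      show "F \<in> borel_measurable (torus \<Otimes>\<^sub>M stieltjes W)"
        unfolding F_def split_def by measurable
      show "integrable (torus \<Otimes>\<^sub>M stieltjes W) (\<lambda>z. \<phi> (fst z) * B')"
        by (rule P.Fubini_integrable) (use \<phi>_int in \<open>simp_all add: abs_mult\<close>)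
      show "AE z in torus \<Otimes>\<^sub>M stieltjes W. norm (F z) \<le> norm (\<phi> (fst z) * B')"
        unfolding F_def using q(2) B' by (intro AE_I2) (auto simp: abs_mult intro!: mult_left_mono)
    qed
    have "l2_inner torus \<phi> (potential W a' q) =
        (LINT x|torus. a' * \<phi> x + (LINT y|stieltjes W. F (x, y)))"
      unfolding l2_inner_def F_def potential_def
      by (rule Bochner_Integration.integral_cong) (auto simp: distrib_left mult.commute)
    also have "\<dots> = (LINT x|torus. LINT y|stieltjes W. F (x, y))"
      using \<phi>_int \<phi>_int0 P.integrable_fst'[OF F] by simp
    also have "\<dots> = (LINT y|stieltjes W. LINT x|torus. F (x, y))"
      using P.Fubini_integral[of "\<lambda>x y. F (x, y)"] F by simp
    also have "\<dots> = (LINT y|stieltjes W. - (\<Phi> y * q y))"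
    proof (rule Bochner_Integration.integral_cong[OF refl])
      fix y
      have "(LINT x|torus. F (x, y)) = (LINT x|torus. q y * (\<phi> x - (if x < y then \<phi> x else 0)))"
        by (rule Bochner_Integration.integral_cong) (auto simp: F_def)
      also have "\<dots> = - (\<Phi> y * q y)"
        using \<phi>_int cut_int \<phi>_int0 by (simp add: \<Phi>_def)
      finally show "(LINT x|torus. F (x, y)) = - (\<Phi> y * q y)" .
    qed
    also have "\<dots> = (LINT y|stieltjes W. b * q y) - (LINT y|stieltjes W. p y * q y)"
    proof -
      have "integrable (stieltjes W) (\<lambda>y. p y * q y)"
        using L2_integrable_mult[OF L2_stieltjes[OF p] L2_stieltjes[OF q]] .
      moreover have "integrable (stieltjes W) q" using q by (rule integrable_stieltjes)
      ultimately have "(LINT y|stieltjes W. b * q y) - (LINT y|stieltjes W. p y * q y) =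
        (LINT y|stieltjes W. b * q y - p y * q y)" by simp
      also have "\<dots> = (LINT y|stieltjes W. - (\<Phi> y * q y))"
        by (rule Bochner_Integration.integral_cong) (auto simp: p_def algebra_simps)
      finally show ?thesis ..
    qed
    finally show ?thesis using q0 by simp
  qed
  show ?thesis
    using p p0 ae' green by (intro exI[of _ a] exI[of _ p] exI[of _ "\<bar>b\<bar> + K"]) auto
qed

text \<open>
  Finiteness of the low spectrum usually comes from a compact resolvent; here it comes from a count.
  By Green's formula the fluxes of the orthonormal eigenvectors \<open>f\<close> are orthogonal in \<open>L\<^sup>2(dW)\<close> with squared norms \<open>\<kappa> f\<close>; in particular
  \<open>\<kappa> f \<ge> 0\<close>.  Let \<open>R f\<close> be the potential that represents \<open>f\<close>.  Fix \<open>x\<close> and take the combination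
  \<open>u = \<Sum>R f x * R f\<close>.  It satisfies \<open>u x = S x\<close> and \<open>\<parallel>u\<parallel>\<^sup>2 = S x\<close> for \<open>S x = \<Sum>(R f x)\<^sup>2\<close>, and its energy is
  at most \<open>C * S x\<close>.  The pointwise inequality bounds \<open>(S x)\<^sup>2\<close> by \<open>(2 + 2 * W 1 * C) * S x\<close>.  Hence \<open>S\<close> is
  bounded by \<open>2 + 2 * W 1 * C\<close>, and its integral is the number of eigenvectors.
\<close>

lemma card_low_eigenvectors:
  assumes fin: "finite F" and F: "F \<subseteq> L2 torus"
    and orth: "\<And>f g. f \<in> F \<Longrightarrow> g \<in> F \<Longrightarrow> l2_inner torus f g = (if f = g then 1 else 0)"
    and eig: "\<And>f. f \<in> F \<Longrightarrow> gen_deriv W f (\<phi> f) \<and> ae_eq torus (\<phi> f) (\<lambda>x. - \<kappa> f * f x)"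
    and le: "\<And>f. f \<in> F \<Longrightarrow> \<kappa> f \<le> C"
    and C: "0 \<le> C"
  shows "real (card F) \<le> 2 + 2 * W 1 * C" and "\<And>f. f \<in> F \<Longrightarrow> 0 \<le> \<kappa> f"
proof -
  interpret T: prob_space torus by (rule prob_space_torus)
  have "\<forall>f\<in>F. \<exists>a p B. p \<in> borel_measurable borel \<and> (\<forall>y. \<bar>p y\<bar> \<le> B) \<and>
    (LINT y|stieltjes W. p y) = 0 \<and> ae_eq torus f (potential W a p) \<and>
    (\<forall>q a' B'. q \<in> borel_measurable borel \<and> (\<forall>y. \<bar>q y\<bar> \<le> B') \<and> (LINT y|stieltjes W. q y) = 0 \<longrightarrow>
      l2_inner torus (\<phi> f) (potential W a' q) = - (LINT y|stieltjes W. p y * q y))"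
    using gen_deriv_flux eig by blast
  then obtain a p B where
    p: "\<And>f. f \<in> F \<Longrightarrow> p f \<in> borel_measurable borel" "\<And>f y. f \<in> F \<Longrightarrow> \<bar>p f y\<bar> \<le> B f"
    and p0: "\<And>f. f \<in> F \<Longrightarrow> (LINT y|stieltjes W. p f y) = 0"
    and ae: "\<And>f. f \<in> F \<Longrightarrow> ae_eq torus f (potential W (a f) (p f))"
    and green: "\<And>f q a' B'. f \<in> F \<Longrightarrow> q \<in> borel_measurable borel \<Longrightarrow> (\<And>y. \<bar>q y\<bar> \<le> B') \<Longrightarrow>
        (LINT y|stieltjes W. q y) = 0 \<Longrightarrow>
        l2_inner torus (\<phi> f) (potential W a' q) = - (LINT y|stieltjes W. p f y * q y)"
    unfolding bchoice_iff by blast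
  define R where "R f = potential W (a f) (p f)" for f
  have R: "R f \<in> L2 torus" if "f \<in> F" for f
    unfolding R_def using p that by (intro potential_L2) auto
  have RR: "l2_inner torus (R f) (R g) = (if f = g then 1 else 0)" if "f \<in> F" "g \<in> F" for f g
  proof -
    have "l2_inner torus f g = l2_inner torus (R f) (R g)"
      using F that ae unfolding R_def
      by (intro l2_inner_cong_AE R[unfolded R_def]) blast+
    then show ?thesis using orth[OF that] by simp
  qed
  have pp: "l2_inner (stieltjes W) (p f) (p g) = (if f = g then \<kappa> f else 0)" if fg: "f \<in> F" "g \<in> F" for f g
  proof -
    have \<phi>L2: "\<phi> f \<in> L2 torus" using eig[OF fg(1)] by (simp add: gen_deriv_def)
    have fL2: "f \<in> L2 torus" "g \<in> L2 torus" using F fg by auto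
    have "ae_eq torus (R g) g" using ae[OF fg(2)] by (auto simp: R_def elim: eventually_mono)
    then have "l2_inner torus (\<phi> f) (R g) = l2_inner torus (\<lambda>x. - \<kappa> f * f x) g"
      using eig[OF fg(1)] by (intro l2_inner_cong_AE \<phi>L2 R fg L2_scale fL2) auto
    also have "\<dots> = - \<kappa> f * (if f = g then 1 else 0)"
      using orth[OF fg] by (simp only: l2_inner_scale_left)
    finally show ?thesis
      using green[OF fg(1) p(1)[OF fg(2)] p(2)[OF fg(2)] p0[OF fg(2)], of "a g"]
      by (simp add: R_def l2_inner_def split: if_splits)
  qed
  show nonneg: "0 \<le> \<kappa> f" if "f \<in> F" for f
    using pp[OF that that] l2_inner_self_nonneg[of "stieltjes W" "p f"] by simp
  have pL2: "p f \<in> L2 (stieltjes W)" if "f \<in> F" for f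
    using L2_stieltjes[OF p(1)[OF that] p(2)[OF that]] .
  define S where "S x = (\<Sum>f\<in>F. (R f x)\<^sup>2)" for x
  have S0: "0 \<le> S x" for x by (simp add: S_def sum_nonneg)
  have S_le: "S x \<le> 2 + 2 * W 1 * C" for x
  proof -
    define c where "c f = R f x" for f
    define q where "q y = (\<Sum>f\<in>F. c f * p f y)" for y
    define A where "A = (\<Sum>f\<in>F. c f * a f)"
    have q: "q \<in> borel_measurable borel" "\<bar>q y\<bar> \<le> (\<Sum>f\<in>F. \<bar>c f\<bar> * B f)" for y
    proof -
      show "q \<in> borel_measurable borel"
        unfolding q_def using p by (intro borel_measurable_sum borel_measurable_times) auto
      show "\<bar>q y\<bar> \<le> (\<Sum>f\<in>F. \<bar>c f\<bar> * B f)"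
        unfolding q_def using p(2)
        by (intro order_trans[OF sum_abs] sum_mono) (auto simp: abs_mult intro!: mult_left_mono)
    qed
    have u: "potential W A q t = (\<Sum>f\<in>F. c f * R f t)" for t
      unfolding A_def q_def R_def using p by (subst potential_sum) auto
    have uu: "l2_inner torus (potential W A q) (potential W A q) = S x"
    proof -
      have "potential W A q = (\<lambda>t. \<Sum>f\<in>F. c f * R f t)" using u by (rule ext)
      then show ?thesis
        using l2_inner_orthonormal_sum[OF fin R RR, of c] by (simp add: S_def c_def)
    qed
    have "(LINT y|stieltjes W. (q y)\<^sup>2) = l2_inner (stieltjes W) q q"
      by (simp add: l2_inner_def power2_eq_square)
    also have "\<dots> = (\<Sum>f\<in>F. c f * l2_inner (stieltjes W) (p f) q)"
      using pL2 L2_stieltjes[OF q]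
      by (subst q_def[abs_def], subst l2_inner_lincomb_sum_left) auto
    also have "\<dots> = (\<Sum>f\<in>F. c f * (\<kappa> f * c f))"
    proof (rule sum.cong[OF refl])
      fix f assume f: "f \<in> F"
      have "l2_inner (stieltjes W) (p f) q = l2_inner (stieltjes W) (\<lambda>y. \<Sum>g\<in>F. c g * p g y) (p f)"
        by (subst l2_inner_commute) (simp add: q_def[abs_def])
      also have "\<dots> = (\<Sum>g\<in>F. c g * (if g = f then \<kappa> g else 0))"
        using pL2 f pp by (subst l2_inner_lincomb_sum_left) auto
      also have "\<dots> = \<kappa> f * c f"
        using f fin by (simp add: if_distrib[of "\<lambda>t. _ * t"] cong: if_cong)
      finally show "c f * l2_inner (stieltjes W) (p f) q = c f * (\<kappa> f * c f)" by simp
    qed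
    also have "\<dots> \<le> (\<Sum>f\<in>F. C * (R f x)\<^sup>2)"
    proof (rule sum_mono)
      fix f assume "f \<in> F"
      from mult_right_mono[OF le[OF this], of "(c f)\<^sup>2"]
      show "c f * (\<kappa> f * c f) \<le> C * (R f x)\<^sup>2"
        by (simp add: c_def power2_eq_square mult_ac)
    qed
    finally have E: "(LINT y|stieltjes W. (q y)\<^sup>2) \<le> C * S x"
      by (simp add: S_def sum_distrib_left)
    have "potential W A q x = S x"
      by (simp add: u S_def c_def power2_eq_square)
    then have "(S x)\<^sup>2 \<le> 2 * S x + 2 * W 1 * (LINT y|stieltjes W. (q y)\<^sup>2)"
      using potential_pointwise[OF q, of A x] uu by simp
    also have "\<dots> \<le> 2 * S x + 2 * W 1 * (C * S x)"
      using E W1_nonneg by (intro add_left_mono mult_left_mono) auto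
    finally have le: "S x * S x \<le> (2 + 2 * W 1 * C) * S x"
      by (simp add: power2_eq_square algebra_simps)
    show ?thesis
    proof (cases "S x = 0")
      case True
      then show ?thesis using C W1_nonneg by simp
    next
      case False
      then show ?thesis using le S0[of x] by simp
    qed
  qed
  show "real (card F) \<le> 2 + 2 * W 1 * C"
  proof -
    have int: "integrable torus (\<lambda>x. (R f x)\<^sup>2)" if "f \<in> F" for f
      using R[OF that] by (rule L2_integrable_square)
    have "real (card F) = (\<Sum>f\<in>F. LINT x|torus. (R f x)\<^sup>2)"
      using RR by (simp add: l2_inner_def power2_eq_square)
    also have "\<dots> = (LINT x|torus. S x)"
      unfolding S_def using int by (subst Bochner_Integration.integral_sum) auto
    also have "\<dots> \<le> (LINT x|torus. 2 + 2 * W 1 * C)"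
      using S_le int unfolding S_def by (intro integral_mono) auto
    also have "\<dots> = 2 + 2 * W 1 * C" by (simp add: T.prob_space)
    finally show ?thesis .
  qed
qed

end

section \<open>The one-dimensional eigenvalues\<close>

text \<open>
  For a normalized eigenvector \<open>f\<close> of \<open>op1 W\<close>, this is the eigenvalue of \<open>- op1 W\<close>.
\<close>

definition eigval :: "(real \<Rightarrow> real) \<Rightarrow> (real \<Rightarrow> real) \<Rightarrow> real" where
  "eigval W f = - l2_inner torus (op1 W f) f"

context
  fixes W A
  assumes A: "eigenbasis1 W A"
begin

lemma eigenbasis_L2: "f \<in> A \<Longrightarrow> f \<in> L2 torus"
  using A unfolding eigenbasis1_def l2_complete_orthonormal_def l2_orthonormal_def by blast

lemma eigenbasis_inner:
  "f \<in> A \<Longrightarrow> g \<in> A \<Longrightarrow> l2_inner torus f g = (if f = g then 1 else 0)"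
  using A unfolding eigenbasis1_def l2_complete_orthonormal_def l2_orthonormal_def by blast

lemma eigenbasis_op:
  assumes f: "f \<in> A"
  shows "gen_deriv W f (op1 W f)" and "ae_eq torus (op1 W f) (\<lambda>x. - eigval W f * f x)"
proof -
  obtain \<mu> where \<mu>: "f \<in> dom1 W" "ae_eq torus (op1 W f) (\<lambda>x. \<mu> * f x)"
    using A f unfolding eigenbasis1_def l2_eigenvector_def by blast
  show gd: "gen_deriv W f (op1 W f)"
    using \<mu>(1) unfolding dom1_def op1_def mem_Collect_eq by (rule someI_ex)
  have "l2_inner torus (op1 W f) f = l2_inner torus (\<lambda>x. \<mu> * f x) f"
    using gd \<mu>(2) eigenbasis_L2[OF f]
    by (intro l2_inner_cong_AE L2_scale) (auto simp: gen_deriv_def)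
  also have "\<dots> = \<mu>" by (simp add: l2_inner_scale_left eigenbasis_inner f)
  finally show "ae_eq torus (op1 W f) (\<lambda>x. - eigval W f * f x)"
    using \<mu>(2) by (simp add: eigval_def)
qed

lemma op1_L2: "f \<in> A \<Longrightarrow> op1 W f \<in> L2 torus"
  using eigenbasis_op(1) by (auto simp: gen_deriv_def)

text \<open>
  Functions in the range of \<open>op1 W\<close> have mean zero, so an eigenvector with nonzero eigenvalue is
  orthogonal to the constants.  If all eigenvalues were nonzero, the constant \<open>1\<close> would be orthogonal to
  a complete system.
\<close>

lemma ex_zero_eigval: "\<exists>f\<in>A. eigval W f = 0"
proof (rule ccontr)
  assume neg: "\<not> (\<exists>f\<in>A. eigval W f = 0)"
  interpret prob_space torus by (rule prob_space_torus)
  have one: "(\<lambda>_. 1) \<in> L2 torus" by (simp add: L2_def)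
  have "l2_inner torus (\<lambda>_. 1) f = 0" if f: "f \<in> A" for f
  proof -
    have "(LINT x|torus. op1 W f x) = 0"
      using eigenbasis_op(1)[OF f] by (simp add: gen_deriv_def integral_torus)
    moreover have "(LINT x|torus. op1 W f x) = (LINT x|torus. - eigval W f * f x)"
      by (intro integral_cong_AE L2_measurable L2_scale op1_L2 eigenbasis_L2 eigenbasis_op(2) f)
    ultimately have "eigval W f * (LINT x|torus. f x) = 0" by simp
    then show ?thesis using neg f by (simp add: l2_inner_def)
  qed
  then have "l2_inner torus (\<lambda>_. 1) (\<lambda>_. 1) = 0"
    using A one unfolding eigenbasis1_def by (intro l2_complete_orthonormal_total) auto
  then show False by (simp add: l2_inner_def prob_space)
qed

context
  assumes W: "admissible W"
begin

lemma card_low_eigval: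
  assumes F: "finite F" "F \<subseteq> A" and le: "\<And>f. f \<in> F \<Longrightarrow> eigval W f \<le> C" and C: "0 \<le> C"
  shows "real (card F) \<le> 2 + 2 * W 1 * C" and "\<And>f. f \<in> F \<Longrightarrow> 0 \<le> eigval W f"
proof -
  have 1: "F \<subseteq> L2 torus" using F eigenbasis_L2 by blast
  have 2: "l2_inner torus f g = (if f = g then 1 else 0)" if "f \<in> F" "g \<in> F" for f g
    using F that eigenbasis_inner by blast
  have 3: "gen_deriv W f (op1 W f) \<and> ae_eq torus (op1 W f) (\<lambda>x. - eigval W f * f x)" if "f \<in> F" for f
    using F that eigenbasis_op by blast
  show "real (card F) \<le> 2 + 2 * W 1 * C"
    by (rule card_low_eigenvectors(1)[OF W F(1) 1 2 3 le C])
  show "0 \<le> eigval W f" if "f \<in> F" for f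
    by (rule card_low_eigenvectors(2)[OF W F(1) 1 2 3 le C that])
qed

lemma eigval_nonneg: "f \<in> A \<Longrightarrow> 0 \<le> eigval W f"
  using card_low_eigval(2)[of "{f}" "max 0 (eigval W f)" f] by simp

lemma finite_low_eigval: "finite {f \<in> A. eigval W f \<le> C}"
proof -
  have "finite {f \<in> A. eigval W f \<le> C} \<and>
      card {f \<in> A. eigval W f \<le> C} \<le> nat \<lfloor>2 + 2 * W 1 * max 0 C\<rfloor>"
  proof (rule finite_if_finite_subsets_card_bdd)
    fix G assume "G \<subseteq> {f \<in> A. eigval W f \<le> C}" "finite G"
    then have "real (card G) \<le> 2 + 2 * W 1 * max 0 C"
      by (intro card_low_eigval(1)) auto
    then show "card G \<le> nat \<lfloor>2 + 2 * W 1 * max 0 C\<rfloor>"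
      by (rule le_nat_floor)
  qed
  then show ?thesis ..
qed

end

end

section \<open>Tensor products\<close>

lemma prob_space_torus_pow: "prob_space (torus_pow d)"
  unfolding torus_pow_def by (rule prob_space_PiM) (rule prob_space_torus)

lemma product_sigma_finite_torus: "product_sigma_finite (\<lambda>_::nat. torus)"
  by (rule product_sigma_finite.intro) (rule prob_space_imp_sigma_finite[OF prob_space_torus])

lemma tensor_measurable:
  assumes "\<And>k. k \<in> {1..d} \<Longrightarrow> f k \<in> borel_measurable torus"
  shows "tensor d f \<in> borel_measurable (torus_pow d)"
  unfolding tensor_def torus_pow_def
  using assms by (intro borel_measurable_prod measurable_compose[OF measurable_component_singleton]) auto

lemma tensor_inner:
  assumes "\<And>k. k \<in> {1..d} \<Longrightarrow> f k \<in> L2 torus" "\<And>k. k \<in> {1..d} \<Longrightarrow> g k \<in> L2 torus"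
  shows "l2_inner (torus_pow d) (tensor d f) (tensor d g) = (\<Prod>k=1..d. l2_inner torus (f k) (g k))"
  using product_sigma_finite.product_integral_prod[OF product_sigma_finite_torus, of "{1..d}" "\<lambda>k x. f k x * g k x"]
    L2_integrable_mult[OF assms]
  by (simp add: l2_inner_def tensor_def torus_pow_def prod.distrib)

lemma tensor_L2:
  assumes "\<And>k. k \<in> {1..d} \<Longrightarrow> f k \<in> L2 torus"
  shows "tensor d f \<in> L2 (torus_pow d)"
  using product_sigma_finite.product_integrable_prod[OF product_sigma_finite_torus, of "{1..d}" "\<lambda>k x. (f k x)\<^sup>2"]
    L2_integrable_square[OF assms] tensor_measurable[OF L2_measurable[OF assms]]
  by (simp add: L2_def tensor_def torus_pow_def prod_power_distrib)

lemma tensor_cong: "(\<And>k. k \<in> {1..d} \<Longrightarrow> f k = g k) \<Longrightarrow> tensor d f = tensor d g"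
  by (auto simp: tensor_def intro!: ext prod.cong)

lemma tensor_coordinate:
  assumes "k \<in> {1..d}"
  shows "tensor d (f(k := u)) x = u (x k) * (\<Prod>j\<in>{1..d} - {k}. f j (x j))"
proof -
  have "tensor d (f(k := u)) x = u (x k) * (\<Prod>j\<in>{1..d} - {k}. (f(k := u)) j (x j))"
    unfolding tensor_def using assms by (subst prod.remove[of _ k]) auto
  also have "(\<Prod>j\<in>{1..d} - {k}. (f(k := u)) j (x j)) = (\<Prod>j\<in>{1..d} - {k}. f j (x j))"
    by (intro prod.cong) auto
  finally show ?thesis .
qed

text \<open>
  The factors are released from \<open>A k\<close> to all of \<open>L\<^sup>2\<close> one coordinate at a time.  With the other factors
  fixed, the tensor product is linear in the factor \<open>f k\<close> and multiplies its norm by a constant, so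
  orthogonality to \<open>v\<close> passes from \<open>A k\<close> to its span and, by density, to \<open>L\<^sup>2\<close>.
\<close>

lemma tensor_orthogonal_extend:
  assumes A: "\<And>k. k \<in> {1..d} \<Longrightarrow> l2_complete_orthonormal torus (A k)"
    and v: "v \<in> L2 (torus_pow d)"
    and orth: "\<And>f. (\<And>k. k \<in> {1..d} \<Longrightarrow> f k \<in> A k) \<Longrightarrow> l2_inner (torus_pow d) (tensor d f) v = 0"
    and J: "finite J" "J \<subseteq> {1..d}"
    and f: "\<And>k. k \<in> {1..d} \<Longrightarrow> f k \<in> L2 torus" "\<And>k. k \<in> {1..d} - J \<Longrightarrow> f k \<in> A k"
  shows "l2_inner (torus_pow d) (tensor d f) v = 0"
  using J f
proof (induction J arbitrary: f rule: finite_induct)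
  case empty
  then show ?case by (intro orth) auto
next
  case (insert k J)
  have AL2: "u \<in> L2 torus" if "j \<in> {1..d}" "u \<in> A j" for j u
  proof -
    have "A j \<subseteq> L2 torus"
      using A[OF that(1)] by (simp add: l2_complete_orthonormal_def l2_orthonormal_def)
    then show ?thesis using that(2) by (rule subsetD)
  qed
  have k: "k \<in> {1..d}" using insert.prems by auto
  have fL2: "(f(k := u)) j \<in> L2 torus" if "j \<in> {1..d}" "u \<in> L2 torus" for j u
    using insert.prems that by auto
  have base: "l2_inner (torus_pow d) (tensor d (f(k := u))) v = 0" if u: "u \<in> A k" for u
  proof (rule insert.IH)
    show "J \<subseteq> {1..d}" using insert.prems by auto
    show "(f(k := u)) j \<in> L2 torus" if "j \<in> {1..d}" for j
      using fL2[OF that AL2[OF k u]] .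
    show "(f(k := u)) j \<in> A j" if "j \<in> {1..d} - J" for j
      using insert.prems(3)[of j] that u by auto
  qed
  have "\<exists>q. q \<in> L2 torus \<and> l2_norm torus (\<lambda>x. f k x - q x) < 1 / real (Suc n) \<and>
      l2_inner (torus_pow d) (tensor d (f(k := q))) v = 0" for n
  proof -
    obtain g where g: "g \<in> l2_span torus (A k)" "l2_norm torus (\<lambda>x. f k x - g x) < 1 / real (Suc n)"
    proof -
      have "l2_dense torus (l2_span torus (A k))"
        using A[OF k] by (simp add: l2_complete_orthonormal_def)
      moreover have "0 < 1 / real (Suc n)" by simp
      ultimately show thesis
        using insert.prems(2)[OF k] that unfolding l2_dense_def by blast
    qed
    then obtain F c where gL2: "g \<in> L2 torus" and F: "F \<subseteq> A k"
      and ae: "ae_eq torus g (\<lambda>x. \<Sum>u\<in>F. c u * u x)"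
      unfolding l2_span_def by blast
    define q where "q x = (\<Sum>u\<in>F. c u * u x)" for x
    have q: "q \<in> L2 torus"
      unfolding q_def using F AL2[OF k] by (intro L2_sum L2_scale) auto
    have "ae_eq torus (\<lambda>x. f k x - q x) (\<lambda>x. f k x - g x)"
      using ae by eventually_elim (simp add: q_def)
    then have "l2_norm torus (\<lambda>x. f k x - q x) = l2_norm torus (\<lambda>x. f k x - g x)"
      by (intro l2_norm_cong_AE L2_diff insert.prems(2)[OF k] q gL2)
    moreover have "l2_inner (torus_pow d) (tensor d (f(k := q))) v = 0"
    proof -
      have "tensor d (f(k := q)) = (\<lambda>x. \<Sum>u\<in>F. c u * tensor d (f(k := u)) x)"
        unfolding tensor_coordinate[OF k] q_def fun_eq_iff by (simp add: sum_distrib_right mult.assoc)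
      then have "l2_inner (torus_pow d) (tensor d (f(k := q))) v =
          (\<Sum>u\<in>F. c u * l2_inner (torus_pow d) (tensor d (f(k := u))) v)"
        using F AL2[OF k] fL2 v
        by (simp only:, intro l2_inner_lincomb_sum_left tensor_L2) blast+
      then show ?thesis using base F by (simp add: subset_iff)
    qed
    ultimately show ?thesis using q g(2) by auto
  qed
  then obtain q where q: "\<And>n. q n \<in> L2 torus"
      "\<And>n. l2_norm torus (\<lambda>x. f k x - q n x) < 1 / real (Suc n)"
      "\<And>n. l2_inner (torus_pow d) (tensor d (f(k := q n))) v = 0" by metis
  define K where "K = (\<Prod>j\<in>{1..d} - {k}. l2_inner torus (f j) (f j))"
  have norm: "l2_norm (torus_pow d) (\<lambda>x. tensor d f x - tensor d (f(k := q n)) x) =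
      sqrt K * l2_norm torus (\<lambda>x. f k x - q n x)" for n
  proof -
    let ?e = "\<lambda>x. f k x - q n x"
    have e: "?e \<in> L2 torus" using insert.prems(2)[OF k] q(1) by (rule L2_diff)
    have "tensor d f x - tensor d (f(k := q n)) x = tensor d (f(k := ?e)) x" for x
      using tensor_coordinate[OF k, of f "f k" x]
      by (simp add: tensor_coordinate[OF k] left_diff_distrib)
    then have "l2_norm (torus_pow d) (\<lambda>x. tensor d f x - tensor d (f(k := q n)) x) =
        sqrt (l2_inner (torus_pow d) (tensor d (f(k := ?e))) (tensor d (f(k := ?e))))"
      by (simp add: l2_norm_def)
    also have "\<dots> = sqrt (\<Prod>j=1..d. l2_inner torus ((f(k := ?e)) j) ((f(k := ?e)) j))"
      using fL2[OF _ e] by (subst tensor_inner) auto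
    also have "(\<Prod>j=1..d. l2_inner torus ((f(k := ?e)) j) ((f(k := ?e)) j)) =
        l2_inner torus ?e ?e * (\<Prod>j\<in>{1..d} - {k}. l2_inner torus ((f(k := ?e)) j) ((f(k := ?e)) j))"
      using k by (subst prod.remove[of _ k]) auto
    also have "(\<Prod>j\<in>{1..d} - {k}. l2_inner torus ((f(k := ?e)) j) ((f(k := ?e)) j)) = K"
      unfolding K_def by (intro prod.cong) auto
    finally show ?thesis by (simp only: l2_norm_def real_sqrt_mult mult.commute)
  qed
  have "(\<lambda>n. l2_norm torus (\<lambda>x. f k x - q n x)) \<longlonglongrightarrow> 0"
  proof (rule tendsto_sandwich[OF _ _ tendsto_const LIMSEQ_inverse_real_of_nat])
    show "\<forall>\<^sub>F n in sequentially. 0 \<le> l2_norm torus (\<lambda>x. f k x - q n x)"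
      by (simp add: l2_norm_nonneg)
    show "\<forall>\<^sub>F n in sequentially. l2_norm torus (\<lambda>x. f k x - q n x) \<le> inverse (real (Suc n))"
      using q(2) by (intro always_eventually allI) (simp add: inverse_eq_divide less_imp_le)
  qed
  then have "(\<lambda>n. l2_norm (torus_pow d) (\<lambda>x. tensor d f x - tensor d (f(k := q n)) x)) \<longlonglongrightarrow> 0"
    unfolding norm by (rule tendsto_mult_right_zero)
  then have "(\<lambda>n. l2_inner (torus_pow d) (tensor d (f(k := q n))) v) \<longlonglongrightarrow> l2_inner (torus_pow d) (tensor d f) v"
    using fL2 q(1) insert.prems(2) v by (intro l2_tendsto_inner tensor_L2) auto
  then show ?case by (simp add: q(3) LIMSEQ_const_iff)
qed

text \<open>
  Boxes form a generator of the product sigma-algebra that is stable under intersection, so a Dynkin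
  argument extends the vanishing of the integral from boxes to all measurable sets; the positivity and
  negativity sets of \<open>v\<close> then give \<open>\<integral>\<bar>v\<bar> = 0\<close>.
\<close>

lemma box_orthogonal_imp_zero:
  assumes v: "v \<in> L2 (torus_pow d)"
    and box: "\<And>X. (\<And>k. k \<in> {1..d} \<Longrightarrow> X k \<in> sets torus) \<Longrightarrow>
      (LINT x:Pi\<^sub>E {1..d} X|torus_pow d. v x) = 0"
  shows "ae_eq (torus_pow d) v (\<lambda>_. 0)"
proof -
  let ?M = "torus_pow d"
  interpret prob_space ?M by (rule prob_space_torus_pow)
  have one: "(\<lambda>_. 1) \<in> L2 ?M" by (simp add: L2_def)
  have int: "integrable ?M v" using L2_integrable_mult[OF v one] by simp
  have sint: "set_integrable ?M X v" if "X \<in> sets ?M" for X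
    using int that unfolding set_integrable_def by (rule integrable_mult_indicator[rotated])
  have sp: "space ?M = Pi\<^sub>E {1..d} (\<lambda>_. space torus)"
    by (simp add: torus_pow_def space_PiM)
  have sets: "sets ?M = sigma_sets (space ?M) (prod_algebra {1..d} (\<lambda>_. torus))"
    unfolding sp by (simp add: torus_pow_def sets_PiM)
  have into: "prod_algebra {1..d} (\<lambda>_. torus) \<subseteq> Pow (space ?M)"
    unfolding sp by (rule prod_algebra_sets_into_space)
  have zero: "(LINT x:X|?M. v x) = 0" if "X \<in> sets ?M" for X
    using Int_stable_prod_algebra into that[unfolded sets]
  proof (induction rule: sigma_sets_induct_disjoint)
    case (basic X)
    then obtain Y where X: "X = Pi\<^sub>E {1..d} Y" and Y: "Y \<in> (\<Pi> j\<in>{1..d}. sets torus)"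
      unfolding prod_algebra_eq_finite[OF finite_atLeastAtMost] by blast
    show ?case unfolding X by (rule box) (rule funcset_mem[OF Y])
  next
    case empty
    show ?case by (simp add: set_lebesgue_integral_def)
  next
    case (compl X)
    then have X: "X \<in> sets ?M" by (simp add: sets)
    have "(LINT x:space ?M|?M. v x) = 0" unfolding sp by (rule box) simp
    moreover have "(LINT x:space ?M|?M. v x) = (LINT x:X|?M. v x) + (LINT x:space ?M - X|?M. v x)"
      using set_integral_Un[of X "space ?M - X" ?M v] sint X sets.sets_into_space[OF X]
      by (auto simp: Un_absorb1)
    ultimately show ?case using compl by simp
  next
    case (union X)
    then have X: "X i \<in> sets ?M" for i by (auto simp: sets)
    have "(LINT x:(\<Union>i. X i)|?M. v x) = (\<Sum>i. (LINT x:X i|?M. v x))"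
      using X union(1) by (intro lebesgue_integral_countable_add sint) (auto simp: disjoint_family_on_def)
    then show ?case using union by simp
  qed
  have [measurable]: "v \<in> borel_measurable ?M" using v by (rule L2_measurable)
  let ?P = "{x \<in> space ?M. 0 < v x}" and ?N = "{x \<in> space ?M. v x < 0}"
  have "(LINT x|?M. \<bar>v x\<bar>) = (LINT x|?M. indicator ?P x *\<^sub>R v x - indicator ?N x *\<^sub>R v x)"
    by (rule Bochner_Integration.integral_cong) (auto split: split_indicator)
  also have "\<dots> = (LINT x:?P|?M. v x) - (LINT x:?N|?M. v x)"
    unfolding set_lebesgue_integral_def
    using sint[of ?P] sint[of ?N] by (intro Bochner_Integration.integral_diff) (auto simp: set_integrable_def)
  also have "\<dots> = 0" by (simp add: zero)
  finally have "AE x in ?M. \<bar>v x\<bar> = 0"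
    using int by (subst (asm) integral_nonneg_eq_0_iff_AE) auto
  then show ?thesis by simp
qed

text \<open>
  The indicator of a box is a tensor product of indicators, to which orthogonality extends.
\<close>

lemma tensor_total:
  assumes A: "\<And>k. k \<in> {1..d} \<Longrightarrow> l2_complete_orthonormal torus (A k)"
    and v: "v \<in> L2 (torus_pow d)"
    and orth: "\<And>f. (\<And>k. k \<in> {1..d} \<Longrightarrow> f k \<in> A k) \<Longrightarrow> l2_inner (torus_pow d) (tensor d f) v = 0"
  shows "ae_eq (torus_pow d) v (\<lambda>_. 0)"
proof (rule box_orthogonal_imp_zero[OF v])
  fix X :: "nat \<Rightarrow> real set"
  assume X: "\<And>k. k \<in> {1..d} \<Longrightarrow> X k \<in> sets torus"
  interpret T: prob_space torus by (rule prob_space_torus)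
  have "indicator (X k) \<in> L2 torus" if "k \<in> {1..d}" for k
    using X[OF that] by (intro L2_bounded[of _ _ 1] T.finite_measure_axioms) (auto split: split_indicator)
  then have "l2_inner (torus_pow d) (tensor d (\<lambda>k. indicator (X k))) v = 0"
    by (intro tensor_orthogonal_extend[OF A v orth, where J = "{1..d}"]) auto
  also have "l2_inner (torus_pow d) (tensor d (\<lambda>k. indicator (X k))) v =
      (LINT x:Pi\<^sub>E {1..d} X|torus_pow d. v x)"
    unfolding l2_inner_def set_lebesgue_integral_def
  proof (rule Bochner_Integration.integral_cong[OF refl])
    fix x assume "x \<in> space (torus_pow d)"
    then have "x \<in> extensional {1..d}" by (simp add: torus_pow_def space_PiM PiE_def)
    then have "tensor d (\<lambda>k. indicator (X k)) x = (indicator (Pi\<^sub>E {1..d} X) x :: real)"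
      by (auto simp: tensor_def indicator_def PiE_iff prod_zero_iff)
    then show "tensor d (\<lambda>k. indicator (X k)) x * v x = indicator (Pi\<^sub>E {1..d} X) x *\<^sub>R v x" by simp
  qed
  finally show "(LINT x:Pi\<^sub>E {1..d} X|torus_pow d. v x) = 0" .
qed

section \<open>Eigenvalues of the tensor basis\<close>

definition tensor_eigval :: "nat \<Rightarrow> (nat \<Rightarrow> real \<Rightarrow> real) \<Rightarrow> (nat \<Rightarrow> real \<Rightarrow> real) \<Rightarrow> real" where
  "tensor_eigval d W f = (\<Sum>k=1..d. eigval (W k) (f k))"

context
  fixes d :: nat and W A
  assumes A: "\<And>k. k \<in> {1..d} \<Longrightarrow> eigenbasis1 (W k) (A k)"
begin

lemma tensor_basis_inner:
  assumes f: "\<And>k. k \<in> {1..d} \<Longrightarrow> f k \<in> A k" and g: "\<And>k. k \<in> {1..d} \<Longrightarrow> g k \<in> A k"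
  shows "l2_inner (torus_pow d) (tensor d f) (tensor d g) =
    (if \<forall>k\<in>{1..d}. f k = g k then 1 else 0)"
proof -
  have "l2_inner (torus_pow d) (tensor d f) (tensor d g) = (\<Prod>k=1..d. l2_inner torus (f k) (g k))"
    using f g by (intro tensor_inner eigenbasis_L2[OF A]) auto
  also have "\<dots> = (\<Prod>k=1..d. if f k = g k then 1 else 0)"
    using f g by (intro prod.cong refl eigenbasis_inner[OF A]) auto
  also have "\<dots> = (if \<forall>k\<in>{1..d}. f k = g k then 1 else 0)"
    by (auto intro: prod.neutral)
  finally show ?thesis .
qed

lemma tensor_basis_L2: "(\<And>k. k \<in> {1..d} \<Longrightarrow> f k \<in> A k) \<Longrightarrow> tensor d f \<in> L2 (torus_pow d)"
  by (intro tensor_L2 eigenbasis_L2[OF A]) auto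

lemma tensor_image_L2:
  assumes f: "\<And>k. k \<in> {1..d} \<Longrightarrow> f k \<in> A k"
  shows "tensor_image d W f \<in> L2 (torus_pow d)"
proof -
  have "tensor_image d W f = (\<lambda>x. \<Sum>k=1..d. tensor d (f(k := op1 (W k) (f k))) x)"
    unfolding tensor_image_def by (intro ext sum.cong refl) (simp add: tensor_coordinate)
  moreover have "tensor d (f(k := op1 (W k) (f k))) \<in> L2 (torus_pow d)" if k: "k \<in> {1..d}" for k
  proof (rule tensor_L2)
    fix j assume j: "j \<in> {1..d}"
    show "(f(k := op1 (W k) (f k))) j \<in> L2 torus"
      using eigenbasis_L2[OF A[OF j] f[OF j]] op1_L2[OF A[OF k] f[OF k]] by auto
  qed
  ultimately show ?thesis by (simp only:) (rule L2_sum)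
qed

lemma tensor_image_AE:
  assumes f: "\<And>k. k \<in> {1..d} \<Longrightarrow> f k \<in> A k"
  shows "ae_eq (torus_pow d) (tensor_image d W f) (\<lambda>x. - tensor_eigval d W f * tensor d f x)"
proof -
  have "\<forall>k\<in>{1..d}. AE x in torus_pow d. op1 (W k) (f k) (x k) = - eigval (W k) (f k) * f k (x k)"
    unfolding torus_pow_def
    using eigenbasis_op(2)[OF A f] prob_space_torus by (intro ballI AE_PiM_component) auto
  then have "AE x in torus_pow d. \<forall>k\<in>{1..d}. op1 (W k) (f k) (x k) = - eigval (W k) (f k) * f k (x k)"
    by (simp add: AE_ball_countable)
  then show ?thesis
  proof eventually_elim
    case (elim x)
    have "tensor_image d W f x = (\<Sum>k=1..d. - eigval (W k) (f k) * tensor d f x)"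
      unfolding tensor_image_def
    proof (rule sum.cong[OF refl])
      fix k assume k: "k \<in> {1..d}"
      have "tensor d f x = f k (x k) * (\<Prod>j\<in>{1..d} - {k}. f j (x j))"
        using tensor_coordinate[OF k, of f "f k" x] by simp
      then show "(\<Prod>j\<in>{1..d} - {k}. f j (x j)) * op1 (W k) (f k) (x k) =
          - eigval (W k) (f k) * tensor d f x"
        using elim k by simp
    qed
    then show ?case by (simp add: tensor_eigval_def sum_negf sum_distrib_right)
  qed
qed

text \<open>
  The representative chosen in \<open>pre_op\<close> comes from some representation of \<open>tensor d f\<close> as a linear
  combination of basis elements, not necessarily the one with a single term.  The inner product with
  \<open>tensor d f\<close> does not depend on this choice: only the terms equal to \<open>tensor d f\<close> contribute.
\<close>

lemma pre_op_inner_tensor: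
  assumes f: "\<And>k. k \<in> {1..d} \<Longrightarrow> f k \<in> A k"
  shows "pre_op d W A (tensor d f) \<in> L2 (torus_pow d)" (is ?L2)
    and "l2_inner (torus_pow d) (pre_op d W A (tensor d f)) (tensor d f) = - tensor_eigval d W f"
proof -
  let ?M = "torus_pow d" and ?w = "pre_op d W A (tensor d f)"
  define rep where "rep w N c g \<longleftrightarrow> (\<forall>i<N. \<forall>k\<in>{1..d}. g i k \<in> A k) \<and>
      ae_eq ?M (tensor d f) (\<lambda>x. \<Sum>i<N. c i * tensor d (g i) x) \<and>
      ae_eq ?M w (\<lambda>x. \<Sum>i<N. c i * tensor_image d W (g i) x)"
    for w and N :: nat and c :: "nat \<Rightarrow> real" and g :: "nat \<Rightarrow> nat \<Rightarrow> real \<Rightarrow> real"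
  have op: "?w = (SOME w. w \<in> L2 ?M \<and> (\<exists>N c g. rep w N c g))"
    unfolding pre_op_def rep_def ..
  have "rep (tensor_image d W f) 1 (\<lambda>_. 1) (\<lambda>_. f)"
    using f by (simp add: rep_def)
  then have "\<exists>w. w \<in> L2 ?M \<and> (\<exists>N c g. rep w N c g)"
    using tensor_image_L2[OF f] by blast
  then have P: "?w \<in> L2 ?M \<and> (\<exists>N c g. rep ?w N c g)"
    unfolding op by (rule someI_ex)
  then obtain N c g where wL2: "?w \<in> L2 ?M" and "rep ?w N c g" by blast
  then have g: "\<And>i k. i < N \<Longrightarrow> k \<in> {1..d} \<Longrightarrow> g i k \<in> A k"
    and eq: "ae_eq ?M (tensor d f) (\<lambda>x. \<Sum>i<N. c i * tensor d (g i) x)"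
    and im: "ae_eq ?M ?w (\<lambda>x. \<Sum>i<N. c i * tensor_image d W (g i) x)"
    by (simp_all add: rep_def)
  show ?L2 by (rule wL2)
  have fL2: "tensor d f \<in> L2 ?M" by (rule tensor_basis_L2[OF f])
  have gL2: "tensor d (g i) \<in> L2 ?M" if "i \<in> {..<N}" for i
    using that g by (intro tensor_basis_L2) auto
  have giL2: "tensor_image d W (g i) \<in> L2 ?M" if "i \<in> {..<N}" for i
    using that g by (intro tensor_image_L2) auto
  have "l2_inner ?M ?w (tensor d f) = l2_inner ?M (\<lambda>x. \<Sum>i<N. c i * tensor_image d W (g i) x) (tensor d f)"
    using im by (intro l2_inner_cong_AE wL2 fL2 L2_sum L2_scale giL2) auto
  also have "\<dots> = (\<Sum>i<N. c i * l2_inner ?M (tensor_image d W (g i)) (tensor d f))"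
    using giL2 fL2 by (rule l2_inner_lincomb_sum_left)
  also have "\<dots> = (\<Sum>i<N. - tensor_eigval d W f * (c i * l2_inner ?M (tensor d (g i)) (tensor d f)))"
  proof (rule sum.cong[OF refl])
    fix i assume i: "i \<in> {..<N}"
    have gi: "\<And>k. k \<in> {1..d} \<Longrightarrow> g i k \<in> A k" using g i by auto
    have "l2_inner ?M (tensor_image d W (g i)) (tensor d f) =
        l2_inner ?M (\<lambda>x. - tensor_eigval d W (g i) * tensor d (g i) x) (tensor d f)"
      using tensor_image_AE[OF gi] by (intro l2_inner_cong_AE giL2 fL2 gL2 L2_scale i) auto
    also have "\<dots> = - tensor_eigval d W (g i) * l2_inner ?M (tensor d (g i)) (tensor d f)"
      by (simp only: l2_inner_scale_left)
    \<comment> \<open>The inner product vanishes unless \<open>g i\<close> and \<open>f\<close> have the same factors, hence the same eigenvalue.\<close>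
    also have "\<dots> = - tensor_eigval d W f * l2_inner ?M (tensor d (g i)) (tensor d f)"
      using tensor_basis_inner[OF gi f] by (auto simp: tensor_eigval_def)
    finally show "c i * l2_inner ?M (tensor_image d W (g i)) (tensor d f) =
        - tensor_eigval d W f * (c i * l2_inner ?M (tensor d (g i)) (tensor d f))" by simp
  qed
  also have "\<dots> = - tensor_eigval d W f * (\<Sum>i<N. c i * l2_inner ?M (tensor d (g i)) (tensor d f))"
    by (rule sum_distrib_left[symmetric])
  also have "(\<Sum>i<N. c i * l2_inner ?M (tensor d (g i)) (tensor d f)) =
      l2_inner ?M (\<lambda>x. \<Sum>i<N. c i * tensor d (g i) x) (tensor d f)"
    using gL2 fL2 by (rule l2_inner_lincomb_sum_left[symmetric])
  also have "\<dots> = l2_inner ?M (tensor d f) (tensor d f)"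
    using eq by (intro l2_inner_cong_AE L2_sum L2_scale gL2 fL2) auto
  also have "\<dots> = 1" using tensor_basis_inner[OF f f] by simp
  finally show "l2_inner ?M ?w (tensor d f) = - tensor_eigval d W f" by simp
qed

lemma pre_op_eigenvalue:
  assumes f: "\<And>k. k \<in> {1..d} \<Longrightarrow> f k \<in> A k"
    and ev: "l2_eigenvector (torus_pow d) (pre_dom d A) (\<lambda>v x. - pre_op d W A v x) \<mu> (tensor d f)"
  shows "\<mu> = tensor_eigval d W f"
proof -
  let ?M = "torus_pow d" and ?h = "tensor d f"
  have L2: "?h \<in> L2 ?M" "pre_op d W A ?h \<in> L2 ?M"
    using tensor_basis_L2[OF f] pre_op_inner_tensor(1)[OF f] by auto
  have "l2_inner ?M (\<lambda>x. - pre_op d W A ?h x) ?h = l2_inner ?M (\<lambda>x. \<mu> * ?h x) ?h"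
    using ev L2 unfolding l2_eigenvector_def by (intro l2_inner_cong_AE L2_uminus L2_scale) auto
  also have "\<dots> = \<mu>"
    using tensor_basis_inner[OF f f] by (simp add: l2_inner_scale_left)
  finally show ?thesis
    using pre_op_inner_tensor(2)[OF f] by (simp add: l2_inner_uminus_left)
qed

lemma ex_zero_tensor: "\<exists>f. (\<forall>k\<in>{1..d}. f k \<in> A k) \<and> tensor_eigval d W f = 0"
proof -
  have "\<forall>k\<in>{1..d}. \<exists>u\<in>A k. eigval (W k) u = 0" using ex_zero_eigval[OF A] by blast
  then obtain f where "\<forall>k\<in>{1..d}. f k \<in> A k \<and> eigval (W k) (f k) = 0" by metis
  then show ?thesis by (intro exI[of _ f]) (simp add: tensor_eigval_def)
qed

context
  assumes W: "\<And>k. k \<in> {1..d} \<Longrightarrow> admissible (W k)"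
begin

lemma tensor_eigval_nonneg: "(\<And>k. k \<in> {1..d} \<Longrightarrow> f k \<in> A k) \<Longrightarrow> 0 \<le> tensor_eigval d W f"
  unfolding tensor_eigval_def by (intro sum_nonneg eigval_nonneg[OF A W]) auto

text \<open>
  The eigenvalue of a tensor product is the sum of those of its factors.  These are non-negative, so each
  factor has eigenvalue at most \<open>C\<close>, which leaves finitely many choices in each coordinate.
\<close>

lemma finite_low_tensors:
  "finite {u. \<exists>f. u = tensor d f \<and> (\<forall>k\<in>{1..d}. f k \<in> A k) \<and> tensor_eigval d W f \<le> C}"
proof (rule finite_subset)
  let ?B = "\<lambda>k. {f \<in> A k. eigval (W k) f \<le> C}"
  show "finite (tensor d ` Pi\<^sub>E {1..d} ?B)"
    by (intro finite_imageI finite_PiE finite_low_eigval[OF A W]) auto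
  show "{u. \<exists>f. u = tensor d f \<and> (\<forall>k\<in>{1..d}. f k \<in> A k) \<and> tensor_eigval d W f \<le> C}
      \<subseteq> tensor d ` Pi\<^sub>E {1..d} ?B"
  proof clarify
    fix f assume f: "\<forall>k\<in>{1..d}. f k \<in> A k" and le: "tensor_eigval d W f \<le> C"
    have "eigval (W k) (f k) \<le> C" if k: "k \<in> {1..d}" for k
    proof -
      have "eigval (W k) (f k) \<le> tensor_eigval d W f"
        unfolding tensor_eigval_def
        using f k eigval_nonneg[OF A W] by (intro member_le_sum) auto
      with le show ?thesis by simp
    qed
    then have "restrict f {1..d} \<in> Pi\<^sub>E {1..d} ?B" using f by auto
    moreover have "tensor d f = tensor d (restrict f {1..d})" by (rule tensor_cong) simp
    ultimately show "tensor d f \<in> tensor d ` Pi\<^sub>E {1..d} ?B" by blast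
  qed
qed

end

end

section \<open>The spectral theorem in \<open>d\<close> dimensions\<close>

theorem theorem2p1:
  fixes d :: nat
    and W :: "nat \<Rightarrow> real \<Rightarrow> real"
    and A :: "nat \<Rightarrow> (real \<Rightarrow> real) set"
    and h :: "nat \<Rightarrow> (nat \<Rightarrow> real) \<Rightarrow> real"
    and \<alpha> :: "nat \<Rightarrow> real"
  assumes d: "d > 1"
    and W: "\<And>k. k \<in> {1..d} \<Longrightarrow> admissible (W k)"
    and A: "\<And>k. k \<in> {1..d} \<Longrightarrow> eigenbasis1 (W k) (A k)"
    and h: "bij_betw h UNIV (tensor_basis d A)"
    and \<alpha>: "\<And>k. l2_eigenvector (torus_pow d) (pre_dom d A) (\<lambda>v x. - pre_op d W A v x) (\<alpha> k) (h k)"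
  shows
    "let M = torus_pow d;
         D = diag_dom M h \<alpha>;
         L = diag_op M h \<alpha>;
         nL = (\<lambda>v x. - L v x)
     in
       \<comment> \<open>(a)\<close>
       (l2_dense M D \<and>
        (\<forall>k. l2_eigenvector M D nL (\<alpha> k) (h k)) \<and>
        l2_complete_orthonormal M (tensor_basis d A)) \<and>
       \<comment> \<open>(b)\<close>
       (l2_eigenvalues M D nL = range \<alpha> \<and> countable (range \<alpha>) \<and>
        (\<forall>\<mu> \<in> l2_eigenvalues M D nL. l2_finite_dim M (l2_eigenspace M D nL \<mu>)) \<and>
        (\<exists>\<sigma> :: nat \<Rightarrow> nat. bij \<sigma> \<and> \<alpha> (\<sigma> 0) = 0 \<and> mono (\<lambda>n. \<alpha> (\<sigma> n)) \<and>
           filterlim (\<lambda>n. \<alpha> (\<sigma> n)) at_top sequentially)) \<and>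
       \<comment> \<open>(c)\<close>
       l2_bijective M D (\<lambda>v x. v x - L v x) \<and>
       \<comment> \<open>(d)\<close>
       (l2_self_adjoint M D L \<and> (\<forall>f\<in>D. l2_inner M (nL f) f \<ge> 0)) \<and>
       \<comment> \<open>(e)\<close>
       (\<forall>g\<in>D. \<forall>\<mu>>0. l2_norm M (\<lambda>x. \<mu> * g x) \<le> l2_norm M (\<lambda>x. \<mu> * g x - L g x))"
proof -
  let ?M = "torus_pow d"
  have range: "range h = tensor_basis d A" and inj: "inj h"
    using h by (auto simp: bij_betw_def)
  have "\<exists>f. h k = tensor d f \<and> (\<forall>j\<in>{1..d}. f j \<in> A j)" for k
    using rangeI[of h k] unfolding range tensor_basis_def by blast
  then obtain \<phi> where h_eq: "\<And>k. h k = tensor d (\<phi> k)"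
    and \<phi>: "\<And>k j. j \<in> {1..d} \<Longrightarrow> \<phi> k j \<in> A j" by metis
  have tensor_in_range: "\<exists>k. tensor d f = h k" if "\<And>j. j \<in> {1..d} \<Longrightarrow> f j \<in> A j" for f
    using that range unfolding tensor_basis_def by blast
  have \<alpha>_eq: "\<alpha> k = tensor_eigval d W (\<phi> k)" for k
    using pre_op_eigenvalue[OF A \<phi>[of _ k], where \<mu> = "\<alpha> k"] \<alpha>[of k] by (simp add: h_eq)
  have complete: "l2_complete_orthonormal torus (A k)" if "k \<in> {1..d}" for k
    using A[OF that] by (simp add: eigenbasis1_def)
  interpret diagonal_operator ?M h \<alpha>
  proof
    show "h k \<in> L2 ?M" for k
      unfolding h_eq by (rule tensor_basis_L2[OF A \<phi>])
    show "l2_inner ?M (h j) (h k) = (if j = k then 1 else 0)" for j k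
    proof (cases "\<forall>i\<in>{1..d}. \<phi> j i = \<phi> k i")
      case True
      then have "h j = h k" unfolding h_eq by (intro tensor_cong) auto
      then show ?thesis
        using tensor_basis_inner[OF A \<phi>[of _ k] \<phi>[of _ k]] inj_eq[OF inj, of j k] by (simp add: h_eq)
    next
      case False
      then show ?thesis
        using tensor_basis_inner[OF A \<phi>[of _ j] \<phi>[of _ k]] by (auto simp: h_eq)
    qed
    show "ae_eq ?M f (\<lambda>_. 0)" if "f \<in> L2 ?M" "\<And>k. l2_inner ?M f (h k) = 0" for f
    proof (rule tensor_total[OF complete that(1)])
      fix g assume "\<And>k. k \<in> {1..d} \<Longrightarrow> g k \<in> A k"
      then obtain k where "tensor d g = h k" using tensor_in_range by blast
      then show "l2_inner ?M (tensor d g) f = 0" using that(2)[of k] l2_inner_commute[of ?M f "h k"] by simp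
    qed
    show "0 \<le> \<alpha> k" for k
      unfolding \<alpha>_eq by (rule tensor_eigval_nonneg[OF A W \<phi>])
  qed
  have fin: "finite {k. \<alpha> k \<le> C}" for C
  proof (rule finite_subset)
    let ?U = "{u. \<exists>f. u = tensor d f \<and> (\<forall>k\<in>{1..d}. f k \<in> A k) \<and> tensor_eigval d W f \<le> C}"
    show "{k. \<alpha> k \<le> C} \<subseteq> h -` ?U" using \<phi> by (auto simp: \<alpha>_eq h_eq)
    show "finite (h -` ?U)" by (intro finite_vimageI finite_low_tensors[OF A W] inj)
  qed
  obtain f where f: "\<forall>k\<in>{1..d}. f k \<in> A k" "tensor_eigval d W f = 0"
    using ex_zero_tensor[where d = d and W = W and A = A] A by blast
  then obtain k0 where k0: "tensor d f = h k0" using tensor_in_range by blast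
  have zero: "\<alpha> k0 = 0"
    using pre_op_eigenvalue[OF A, where f = f and \<mu> = "\<alpha> k0"] \<alpha>[of k0] f by (simp add: k0)
  have "l2_finite_dim ?M (l2_eigenspace ?M D (\<lambda>v x. - L v x) \<mu>)" for \<mu>
    by (rule eigenspace_finite_dim, rule finite_subset[OF _ fin[of \<mu>]]) auto
  then show ?thesis
    unfolding Let_def
    using dense_dom basis_eigenvector l2_complete_orthonormal_range[unfolded range] eigenvalues
      eigenvalue_enumeration[OF fin \<alpha>_nonneg zero] resolvent_bijective self_adjoint nonneg dissipative
    by (intro conjI allI ballI impI) auto
qed

end
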